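(* Let $R$ be a commutative ring, let $\mathcal{A}$ and $\mathcal{B}$ be $R$-linear abelian categories, and let $M\colon \mathcal{A}^{\mathrm{op}}\otimes\mathcal{B}\to \mathrm{mod}\text{-}R$ be an $R$-linear bifunctor such that for every $A\in\mathcal{A}$ and every $B\in\mathcal{B}$ the functors $M(A,-)\colon\mathcal{B}\to\mathrm{mod}\text{-}R$ and $M(-,B)\colon\mathcal{A}^{\mathrm{op}}\to\mathrm{mod}\text{-}R$ are left exact. Then the glued category $\mathcal{A}\times_M\mathcal{B}$ is abelian.
   Context: $\mathrm{mod}\text{-}R$ is the category of $R$-modules. For $f\colon A\to A'$ in $\mathcal{A}$ and $g\colon B\to B'$ in $\mathcal{B}$, $M(f,g)\colon M(A',B)\to M(A,B')$ denotes the induced $R$-linear map (contravariant in the first variable, covariant in the second). The gluing $\mathcal{A}\times_M\mathcal{B}$ of $\mathcal{A}$ and $\mathcal{B}$ along $M$ is the following category. Objects are triples $(A,B,\mu)$ with $A\in\mathcal{A}$, $B\in\mathcal{B}$, $\mu\in M(A,B)$. A morphism $(A,B,\mu)\to(A',B',\mu')$ is a pair $(f,g)$ with $f\colon A\to A'$ in $\mathcal{A}$ and $g\colon B\to B'$ in $\mathcal{B}$ such that $M(\mathrm{id}_A,g)(\mu)=M(f,\mathrm{id}_{B'})(\mu')$ in $M(A,B')$. Composition and identities are componentwise. *)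

theory Defs
  imports "HOL-Algebra.Module"
begin

section \<open>Categories\<close>

text \<open>
  A category is given by a family of hom-sets. The sets \<open>Hom C X Y\<close> for different pairs of objects
  are not required to be disjoint: in the gluing below a morphism is just a pair, which does not
  determine its source and target. Composition therefore takes the three objects as arguments:
  \<open>Cmp C X Y Z g f\<close> is the composite of \<open>f\<close> from \<open>X\<close> to \<open>Y\<close> with \<open>g\<close> from \<open>Y\<close> to \<open>Z\<close>. All fields are
  meaningful on objects and morphisms of the category only.
\<close>

record ('o, 'm) cat =
  Ob  :: "'o set"
  Hom :: "'o \<Rightarrow> 'o \<Rightarrow> 'm set"
  Idn :: "'o \<Rightarrow> 'm"
  Cmp :: "'o \<Rightarrow> 'o \<Rightarrow> 'o \<Rightarrow> 'm \<Rightarrow> 'm \<Rightarrow> 'm"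

locale category =
  fixes C :: "('o, 'm, 'z) cat_scheme"
  assumes Idn_in_Hom: "X \<in> Ob C \<Longrightarrow> Idn C X \<in> Hom C X X"
    and Cmp_in_Hom: "\<lbrakk>X \<in> Ob C; Y \<in> Ob C; Z \<in> Ob C; f \<in> Hom C X Y; g \<in> Hom C Y Z\<rbrakk>
      \<Longrightarrow> Cmp C X Y Z g f \<in> Hom C X Z"
    and Cmp_Idn_left: "\<lbrakk>X \<in> Ob C; Y \<in> Ob C; f \<in> Hom C X Y\<rbrakk> \<Longrightarrow> Cmp C X Y Y (Idn C Y) f = f"
    and Cmp_Idn_right: "\<lbrakk>X \<in> Ob C; Y \<in> Ob C; f \<in> Hom C X Y\<rbrakk> \<Longrightarrow> Cmp C X X Y f (Idn C X) = f"
    and Cmp_assoc: "\<lbrakk>W \<in> Ob C; X \<in> Ob C; Y \<in> Ob C; Z \<in> Ob C;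
        f \<in> Hom C W X; g \<in> Hom C X Y; h \<in> Hom C Y Z\<rbrakk>
      \<Longrightarrow> Cmp C W Y Z h (Cmp C W X Y g f) = Cmp C W X Z (Cmp C X Y Z h g) f"

definition op_cat :: "('o, 'm, 'z) cat_scheme \<Rightarrow> ('o, 'm) cat" where
  "op_cat C = \<lparr>Ob = Ob C, Hom = (\<lambda>X Y. Hom C Y X), Idn = Idn C,
     Cmp = (\<lambda>X Y Z g f. Cmp C Z Y X f g)\<rparr>"

section \<open>Abelian categories\<close>

definition is_zero_object :: "('o, 'm, 'z) cat_scheme \<Rightarrow> 'o \<Rightarrow> bool" where
  "is_zero_object C Z \<longleftrightarrow>
     Z \<in> Ob C \<and> (\<forall>X\<in>Ob C. (\<exists>!f. f \<in> Hom C X Z) \<and> (\<exists>!f. f \<in> Hom C Z X))"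

text \<open>The zero morphism is the one that factors through a zero object.\<close>

definition is_zero_mor :: "('o, 'm, 'z) cat_scheme \<Rightarrow> 'o \<Rightarrow> 'o \<Rightarrow> 'm \<Rightarrow> bool" where
  "is_zero_mor C X Y z \<longleftrightarrow>
     (\<exists>Z f g. is_zero_object C Z \<and> f \<in> Hom C X Z \<and> g \<in> Hom C Z Y \<and> z = Cmp C X Z Y g f)"

definition is_mono :: "('o, 'm, 'z) cat_scheme \<Rightarrow> 'o \<Rightarrow> 'o \<Rightarrow> 'm \<Rightarrow> bool" where
  "is_mono C X Y m \<longleftrightarrow> X \<in> Ob C \<and> Y \<in> Ob C \<and> m \<in> Hom C X Y \<and>
     (\<forall>W\<in>Ob C. \<forall>u\<in>Hom C W X. \<forall>v\<in>Hom C W X. Cmp C W X Y m u = Cmp C W X Y m v \<longrightarrow> u = v)"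

definition is_epi :: "('o, 'm, 'z) cat_scheme \<Rightarrow> 'o \<Rightarrow> 'o \<Rightarrow> 'm \<Rightarrow> bool" where
  "is_epi C X Y e \<longleftrightarrow> is_mono (op_cat C) Y X e"

text \<open>\<open>is_kernel C X Y f K k\<close>: the morphism \<open>k\<close> from \<open>K\<close> to \<open>X\<close> is a kernel of \<open>f\<close> from \<open>X\<close> to \<open>Y\<close>.\<close>

definition is_kernel :: "('o, 'm, 'z) cat_scheme \<Rightarrow> 'o \<Rightarrow> 'o \<Rightarrow> 'm \<Rightarrow> 'o \<Rightarrow> 'm \<Rightarrow> bool" where
  "is_kernel C X Y f K k \<longleftrightarrow>
     X \<in> Ob C \<and> Y \<in> Ob C \<and> f \<in> Hom C X Y \<and> K \<in> Ob C \<and> k \<in> Hom C K X \<and>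
     is_zero_mor C K Y (Cmp C K X Y f k) \<and>
     (\<forall>W\<in>Ob C. \<forall>h\<in>Hom C W X. is_zero_mor C W Y (Cmp C W X Y f h) \<longrightarrow>
        (\<exists>!u. u \<in> Hom C W K \<and> Cmp C W K X k u = h))"

text \<open>\<open>is_cokernel C X Y f Q q\<close>: the morphism \<open>q\<close> from \<open>Y\<close> to \<open>Q\<close> is a cokernel of \<open>f\<close> from \<open>X\<close> to \<open>Y\<close>.\<close>

definition is_cokernel :: "('o, 'm, 'z) cat_scheme \<Rightarrow> 'o \<Rightarrow> 'o \<Rightarrow> 'm \<Rightarrow> 'o \<Rightarrow> 'm \<Rightarrow> bool" where
  "is_cokernel C X Y f Q q \<longleftrightarrow> is_kernel (op_cat C) Y X f Q q"

definition is_product :: "('o, 'm, 'z) cat_scheme \<Rightarrow> 'o \<Rightarrow> 'o \<Rightarrow> 'o \<Rightarrow> 'm \<Rightarrow> 'm \<Rightarrow> bool" where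
  "is_product C X Y P p q \<longleftrightarrow>
     X \<in> Ob C \<and> Y \<in> Ob C \<and> P \<in> Ob C \<and> p \<in> Hom C P X \<and> q \<in> Hom C P Y \<and>
     (\<forall>W\<in>Ob C. \<forall>f\<in>Hom C W X. \<forall>g\<in>Hom C W Y.
        \<exists>!u. u \<in> Hom C W P \<and> Cmp C W P X p u = f \<and> Cmp C W P Y q u = g)"

text \<open>
  The additive group on the hom-set from \<open>X\<close> to \<open>Y\<close> is \<open>G X Y\<close>. Abelian groups are ring records in
  the library; the multiplicative fields are irrelevant.
\<close>

locale preadditive_category = category C
  for C :: "('o, 'm, 'z) cat_scheme" +
  fixes G :: "'o \<Rightarrow> 'o \<Rightarrow> 'm ring"
  assumes hom_group: "\<lbrakk>X \<in> Ob C; Y \<in> Ob C\<rbrakk> \<Longrightarrow> abelian_group (G X Y)"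
    and hom_carrier: "\<lbrakk>X \<in> Ob C; Y \<in> Ob C\<rbrakk> \<Longrightarrow> carrier (G X Y) = Hom C X Y"
    and Cmp_add_left: "\<lbrakk>X \<in> Ob C; Y \<in> Ob C; Z \<in> Ob C;
        f \<in> Hom C X Y; g \<in> Hom C Y Z; g' \<in> Hom C Y Z\<rbrakk>
      \<Longrightarrow> Cmp C X Y Z (g \<oplus>\<^bsub>G Y Z\<^esub> g') f = Cmp C X Y Z g f \<oplus>\<^bsub>G X Z\<^esub> Cmp C X Y Z g' f"
    and Cmp_add_right: "\<lbrakk>X \<in> Ob C; Y \<in> Ob C; Z \<in> Ob C;
        f \<in> Hom C X Y; f' \<in> Hom C X Y; g \<in> Hom C Y Z\<rbrakk>
      \<Longrightarrow> Cmp C X Y Z g (f \<oplus>\<^bsub>G X Y\<^esub> f') = Cmp C X Y Z g f \<oplus>\<^bsub>G X Z\<^esub> Cmp C X Y Z g f'"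

text \<open>
  Being abelian is a property of the bare category. In the presence of a zero object and binary
  products there is at most one preadditive structure, so quantifying over it existentially
  involves no choice; in particular it agrees with the additive structure underlying any
  \<open>R\<close>-linear structure on the category.
\<close>

locale additive_category = category C
  for C :: "('o, 'm, 'z) cat_scheme" +
  assumes ex_preadditive: "\<exists>G. preadditive_category C G"
    and ex_zero_object: "\<exists>Z. is_zero_object C Z"
    and ex_product: "\<lbrakk>X \<in> Ob C; Y \<in> Ob C\<rbrakk> \<Longrightarrow> \<exists>P p q. is_product C X Y P p q"

locale abelian_category = additive_category C
  for C :: "('o, 'm, 'z) cat_scheme" +
  assumes ex_kernel: "\<lbrakk>X \<in> Ob C; Y \<in> Ob C; f \<in> Hom C X Y\<rbrakk> \<Longrightarrow> \<exists>K k. is_kernel C X Y f K k"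
    and ex_cokernel: "\<lbrakk>X \<in> Ob C; Y \<in> Ob C; f \<in> Hom C X Y\<rbrakk> \<Longrightarrow> \<exists>Q q. is_cokernel C X Y f Q q"
    and mono_is_kernel: "is_mono C X Y m \<Longrightarrow> \<exists>Z f. is_kernel C Y Z f X m"
    and epi_is_cokernel: "is_epi C X Y e \<Longrightarrow> \<exists>W f. is_cokernel C W X f Y e"

section \<open>\<open>R\<close>-linear categories and bifunctors\<close>

record ('r, 'o, 'm) lin_cat = "('o, 'm) cat" +
  HomM :: "'o \<Rightarrow> 'o \<Rightarrow> ('r, 'm) module"

locale linear_category = R?: cring R + category C
  for R :: "('r, 'k) ring_scheme" and C :: "('r, 'o, 'm, 'z) lin_cat_scheme" +
  assumes hom_module: "\<lbrakk>X \<in> Ob C; Y \<in> Ob C\<rbrakk> \<Longrightarrow> module R (HomM C X Y)"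
    and hom_carrier: "\<lbrakk>X \<in> Ob C; Y \<in> Ob C\<rbrakk> \<Longrightarrow> carrier (HomM C X Y) = Hom C X Y"
    and Cmp_add_left: "\<lbrakk>X \<in> Ob C; Y \<in> Ob C; Z \<in> Ob C;
        f \<in> Hom C X Y; g \<in> Hom C Y Z; g' \<in> Hom C Y Z\<rbrakk>
      \<Longrightarrow> Cmp C X Y Z (g \<oplus>\<^bsub>HomM C Y Z\<^esub> g') f = Cmp C X Y Z g f \<oplus>\<^bsub>HomM C X Z\<^esub> Cmp C X Y Z g' f"
    and Cmp_add_right: "\<lbrakk>X \<in> Ob C; Y \<in> Ob C; Z \<in> Ob C;
        f \<in> Hom C X Y; f' \<in> Hom C X Y; g \<in> Hom C Y Z\<rbrakk>
      \<Longrightarrow> Cmp C X Y Z g (f \<oplus>\<^bsub>HomM C X Y\<^esub> f') = Cmp C X Y Z g f \<oplus>\<^bsub>HomM C X Z\<^esub> Cmp C X Y Z g f'"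
    and Cmp_smult_left: "\<lbrakk>X \<in> Ob C; Y \<in> Ob C; Z \<in> Ob C;
        r \<in> carrier R; f \<in> Hom C X Y; g \<in> Hom C Y Z\<rbrakk>
      \<Longrightarrow> Cmp C X Y Z (r \<odot>\<^bsub>HomM C Y Z\<^esub> g) f = r \<odot>\<^bsub>HomM C X Z\<^esub> Cmp C X Y Z g f"
    and Cmp_smult_right: "\<lbrakk>X \<in> Ob C; Y \<in> Ob C; Z \<in> Ob C;
        r \<in> carrier R; f \<in> Hom C X Y; g \<in> Hom C Y Z\<rbrakk>
      \<Longrightarrow> Cmp C X Y Z g (r \<odot>\<^bsub>HomM C X Y\<^esub> f) = r \<odot>\<^bsub>HomM C X Z\<^esub> Cmp C X Y Z g f"

definition linear_map ::
  "('r, 'k) ring_scheme \<Rightarrow> ('r, 'x) module \<Rightarrow> ('r, 'x) module \<Rightarrow> ('x \<Rightarrow> 'x) \<Rightarrow> bool" where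
  "linear_map R N N' h \<longleftrightarrow>
     h \<in> carrier N \<rightarrow> carrier N' \<and>
     (\<forall>x\<in>carrier N. \<forall>y\<in>carrier N. h (x \<oplus>\<^bsub>N\<^esub> y) = h x \<oplus>\<^bsub>N'\<^esub> h y) \<and>
     (\<forall>r\<in>carrier R. \<forall>x\<in>carrier N. h (r \<odot>\<^bsub>N\<^esub> x) = r \<odot>\<^bsub>N'\<^esub> h x)"

text \<open>
  \<open>bi_ob M A B\<close> is the module \<open>M(A, B)\<close>; for \<open>f\<close> from \<open>A\<close> to \<open>A'\<close> and \<open>g\<close> from \<open>B\<close> to \<open>B'\<close>,
  \<open>bi_map M A A' B B' f g\<close> is the map \<open>M(f, g)\<close> from \<open>M(A', B)\<close> to \<open>M(A, B')\<close>.
\<close>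

record ('r, 'a, 'ma, 'b, 'mb, 'x) bifunctor =
  bi_ob :: "'a \<Rightarrow> 'b \<Rightarrow> ('r, 'x) module"
  bi_map :: "'a \<Rightarrow> 'a \<Rightarrow> 'b \<Rightarrow> 'b \<Rightarrow> 'ma \<Rightarrow> 'mb \<Rightarrow> 'x \<Rightarrow> 'x"

text \<open>
  An \<open>R\<close>-linear functor on \<open>\<A>\<^sup>o\<^sup>p \<otimes> \<B>\<close>, whose hom-modules are tensor products of those of
  \<open>\<A>\<close> and \<open>\<B>\<close>, is by the universal property of the tensor product a functor
  of two variables whose action on morphisms is \<open>R\<close>-bilinear. Equality of linear maps is equality
  on the carrier of the source.
\<close>

locale linear_bifunctor =
  A: linear_category R \<A> + B: linear_category R \<B>
  for R :: "('r, 'k) ring_scheme"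
    and \<A> :: "('r, 'a, 'ma, 'za) lin_cat_scheme"
    and \<B> :: "('r, 'b, 'mb, 'zb) lin_cat_scheme" +
  fixes M :: "('r, 'a, 'ma, 'b, 'mb, 'x) bifunctor"
  assumes bi_module: "\<lbrakk>A \<in> Ob \<A>; B \<in> Ob \<B>\<rbrakk> \<Longrightarrow> module R (bi_ob M A B)"
    and bi_linear: "\<lbrakk>A \<in> Ob \<A>; A' \<in> Ob \<A>; B \<in> Ob \<B>; B' \<in> Ob \<B>; f \<in> Hom \<A> A A'; g \<in> Hom \<B> B B'\<rbrakk>
      \<Longrightarrow> linear_map R (bi_ob M A' B) (bi_ob M A B') (bi_map M A A' B B' f g)"
    and bi_Idn: "\<lbrakk>A \<in> Ob \<A>; B \<in> Ob \<B>; x \<in> carrier (bi_ob M A B)\<rbrakk>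
      \<Longrightarrow> bi_map M A A B B (Idn \<A> A) (Idn \<B> B) x = x"
    and bi_Cmp: "\<lbrakk>A \<in> Ob \<A>; A' \<in> Ob \<A>; A'' \<in> Ob \<A>; B \<in> Ob \<B>; B' \<in> Ob \<B>; B'' \<in> Ob \<B>;
        f \<in> Hom \<A> A A'; f' \<in> Hom \<A> A' A''; g \<in> Hom \<B> B B'; g' \<in> Hom \<B> B' B'';
        x \<in> carrier (bi_ob M A'' B)\<rbrakk>
      \<Longrightarrow> bi_map M A A'' B B'' (Cmp \<A> A A' A'' f' f) (Cmp \<B> B B' B'' g' g) x =
          bi_map M A A' B' B'' f g' (bi_map M A' A'' B B' f' g x)"
    and bi_add_left: "\<lbrakk>A \<in> Ob \<A>; A' \<in> Ob \<A>; B \<in> Ob \<B>; B' \<in> Ob \<B>;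
        f \<in> Hom \<A> A A'; f' \<in> Hom \<A> A A'; g \<in> Hom \<B> B B'; x \<in> carrier (bi_ob M A' B)\<rbrakk>
      \<Longrightarrow> bi_map M A A' B B' (f \<oplus>\<^bsub>HomM \<A> A A'\<^esub> f') g x =
          bi_map M A A' B B' f g x \<oplus>\<^bsub>bi_ob M A B'\<^esub> bi_map M A A' B B' f' g x"
    and bi_add_right: "\<lbrakk>A \<in> Ob \<A>; A' \<in> Ob \<A>; B \<in> Ob \<B>; B' \<in> Ob \<B>;
        f \<in> Hom \<A> A A'; g \<in> Hom \<B> B B'; g' \<in> Hom \<B> B B'; x \<in> carrier (bi_ob M A' B)\<rbrakk>
      \<Longrightarrow> bi_map M A A' B B' f (g \<oplus>\<^bsub>HomM \<B> B B'\<^esub> g') x =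
          bi_map M A A' B B' f g x \<oplus>\<^bsub>bi_ob M A B'\<^esub> bi_map M A A' B B' f g' x"
    and bi_smult_left: "\<lbrakk>A \<in> Ob \<A>; A' \<in> Ob \<A>; B \<in> Ob \<B>; B' \<in> Ob \<B>;
        r \<in> carrier R; f \<in> Hom \<A> A A'; g \<in> Hom \<B> B B'; x \<in> carrier (bi_ob M A' B)\<rbrakk>
      \<Longrightarrow> bi_map M A A' B B' (r \<odot>\<^bsub>HomM \<A> A A'\<^esub> f) g x =
          r \<odot>\<^bsub>bi_ob M A B'\<^esub> bi_map M A A' B B' f g x"
    and bi_smult_right: "\<lbrakk>A \<in> Ob \<A>; A' \<in> Ob \<A>; B \<in> Ob \<B>; B' \<in> Ob \<B>;
        r \<in> carrier R; f \<in> Hom \<A> A A'; g \<in> Hom \<B> B B'; x \<in> carrier (bi_ob M A' B)\<rbrakk>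
      \<Longrightarrow> bi_map M A A' B B' f (r \<odot>\<^bsub>HomM \<B> B B'\<^esub> g) x =
          r \<odot>\<^bsub>bi_ob M A B'\<^esub> bi_map M A A' B B' f g x"

text \<open>
  Left exactness of a functor from an abelian category to \<open>R\<close>-modules, with object part \<open>F\<close> and
  morphism part \<open>\<phi>\<close>: it takes exact sequences \<open>0 \<rightarrow> X \<rightarrow> Y \<rightarrow> Z\<close>, i.e. pairs in which the first
  map is a kernel of the second, to exact sequences \<open>0 \<rightarrow> F X \<rightarrow> F Y \<rightarrow> F Z\<close>.
\<close>

definition left_exact ::
  "('o, 'm, 'z) cat_scheme \<Rightarrow> ('o \<Rightarrow> ('r, 'x) module) \<Rightarrow> ('o \<Rightarrow> 'o \<Rightarrow> 'm \<Rightarrow> 'x \<Rightarrow> 'x) \<Rightarrow> bool" where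
  "left_exact C F \<phi> \<longleftrightarrow>
     (\<forall>X Y Z f g. is_kernel C Y Z g X f \<longrightarrow>
        inj_on (\<phi> X Y f) (carrier (F X)) \<and>
        \<phi> X Y f ` carrier (F X) = {y \<in> carrier (F Y). \<phi> Y Z g y = \<zero>\<^bsub>F Z\<^esub>})"

text \<open>
  \<open>M(A, -)\<close> is a functor on \<open>\<B>\<close> and \<open>M(-, B)\<close> is a functor on the opposite of \<open>\<A>\<close>; a morphism
  from \<open>X\<close> to \<open>Y\<close> in the opposite category is a morphism from \<open>Y\<close> to \<open>X\<close> in \<open>\<A>\<close>.
\<close>

definition bi_fix_left_map ::
  "('a, 'ma, 'za) cat_scheme \<Rightarrow> ('r, 'a, 'ma, 'b, 'mb, 'x) bifunctor
    \<Rightarrow> 'a \<Rightarrow> 'b \<Rightarrow> 'b \<Rightarrow> 'mb \<Rightarrow> 'x \<Rightarrow> 'x" where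
  "bi_fix_left_map \<A> M A = (\<lambda>X Y g. bi_map M A A X Y (Idn \<A> A) g)"

definition bi_fix_right_map ::
  "('b, 'mb, 'zb) cat_scheme \<Rightarrow> ('r, 'a, 'ma, 'b, 'mb, 'x) bifunctor
    \<Rightarrow> 'b \<Rightarrow> 'a \<Rightarrow> 'a \<Rightarrow> 'ma \<Rightarrow> 'x \<Rightarrow> 'x" where
  "bi_fix_right_map \<B> M B = (\<lambda>X Y f. bi_map M Y X B B f (Idn \<B> B))"

section \<open>Gluing\<close>

definition glue ::
  "('a, 'ma, 'za) cat_scheme \<Rightarrow> ('b, 'mb, 'zb) cat_scheme \<Rightarrow> ('r, 'a, 'ma, 'b, 'mb, 'x) bifunctor
    \<Rightarrow> ('a \<times> 'b \<times> 'x, 'ma \<times> 'mb) cat" where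
  "glue \<A> \<B> M = \<lparr>
     Ob = {(A, B, \<mu>). A \<in> Ob \<A> \<and> B \<in> Ob \<B> \<and> \<mu> \<in> carrier (bi_ob M A B)},
     Hom = (\<lambda>(A, B, \<mu>) (A', B', \<mu>'). {(f, g). f \<in> Hom \<A> A A' \<and> g \<in> Hom \<B> B B' \<and>
       bi_map M A A B B' (Idn \<A> A) g \<mu> = bi_map M A A' B' B' f (Idn \<B> B') \<mu>'}),
     Idn = (\<lambda>(A, B, \<mu>). (Idn \<A> A, Idn \<B> B)),
     Cmp = (\<lambda>(A, B, \<mu>) (A', B', \<mu>') (A'', B'', \<mu>'') (f', g') (f, g).
       (Cmp \<A> A A' A'' f' f, Cmp \<B> B B' B'' g' g))\<rparr>"

end

theory Submission
  imports Defs
begin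

text \<open>
  The kernel of \<open>(f, g)\<close> from \<open>(A, B, \<mu>)\<close> to \<open>(A', B', \<mu>')\<close> is \<open>(K, L, \<lambda>)\<close> with \<open>K\<close> and \<open>L\<close> the
  kernels of \<open>f\<close> and \<open>g\<close>: the restriction of \<open>\<mu>\<close> to \<open>M(K, B)\<close> dies in \<open>M(K, B')\<close>, so it lifts
  to a unique \<open>\<lambda>\<close> in \<open>M(K, L)\<close> by left exactness of \<open>M(K, -)\<close>. Hence the components of a
  monomorphism have zero kernel, so each is the kernel of its cokernel, and left exactness of
  \<open>M(-, B)\<close> supplies the element which makes the pair of cokernels a morphism of the gluing.

  Passing to the opposite category of the gluing exchanges the roles of \<open>\<A>\<^sup>o\<^sup>p\<close> and \<open>\<B>\<close>. The argument
  is therefore carried out for two categories acting covariantly on a family of groups, and for any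
  category that is described by such data as the gluing is; cokernels and epimorphisms then come for
  free.
\<close>

section \<open>Opposite categories and zero morphisms\<close>

lemma op_cat_simps [simp]:
  "Ob (op_cat C) = Ob C" "Hom (op_cat C) X Y = Hom C Y X" "Idn (op_cat C) = Idn C"
  "Cmp (op_cat C) X Y Z g f = Cmp C Z Y X f g"
  by (simp_all add: op_cat_def)

lemma is_zero_object_op [simp]: "is_zero_object (op_cat C) Z \<longleftrightarrow> is_zero_object C Z"
  by (auto simp: is_zero_object_def)

lemma is_zero_mor_op [simp]: "is_zero_mor (op_cat C) X Y f \<longleftrightarrow> is_zero_mor C Y X f"
  by (auto simp: is_zero_mor_def)

text \<open>\<open>op_cat\<close> forgets additional record fields, so a double opposite may have a
  different type from the original category. The predicates read the basic fields only and cannot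
  tell the two apart.\<close>

lemma op_op [simp]:
  "is_mono (op_cat (op_cat C)) = is_mono C"
  "is_kernel (op_cat (op_cat C)) = is_kernel C"
  "is_product (op_cat (op_cat C)) = is_product C"
  by (auto simp: is_mono_def is_kernel_def is_product_def fun_eq_iff)

context category
begin

lemma category_op: "category (op_cat C)"
  by unfold_locales (auto intro: Idn_in_Hom Cmp_in_Hom simp: Cmp_Idn_left Cmp_Idn_right Cmp_assoc)

text \<open>A zero morphism comes with some zero object \<open>Z'\<close> of its own. It can be
  rerouted through any other zero object \<open>Z\<close>, since the map from \<open>Z'\<close> to
  \<open>Y\<close> is unique and so equals the one that passes through \<open>Z\<close>.\<close>

lemma zero_mor_factor:
  assumes "is_zero_object C Z" "is_zero_mor C X Y h" "X \<in> Ob C" "Y \<in> Ob C"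
  obtains f g where "f \<in> Hom C X Z" "g \<in> Hom C Z Y" "h = Cmp C X Z Y g f"
proof -
  obtain Z' f g where h: "is_zero_object C Z'" "f \<in> Hom C X Z'" "g \<in> Hom C Z' Y"
    "h = Cmp C X Z' Y g f"
    using assms(2) by (auto simp: is_zero_mor_def)
  obtain i where i: "i \<in> Hom C Z' Z" using assms(1) h(1) by (auto simp: is_zero_object_def)
  obtain j where j: "j \<in> Hom C Z Y" using assms by (auto simp: is_zero_object_def)
  have Ob: "Z \<in> Ob C" "Z' \<in> Ob C" using assms(1) h(1) by (auto simp: is_zero_object_def)
  have "Cmp C Z' Z Y j i = g"
    using h(1,3) assms(4) Cmp_in_Hom[OF Ob(2) Ob(1) assms(4) i j]
    unfolding is_zero_object_def by blast
  then have "h = Cmp C X Z Y j (Cmp C X Z' Z i f)"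
    using h Cmp_assoc assms Ob i j by simp
  then show ?thesis using that Cmp_in_Hom h i j assms Ob by blast
qed

end

section \<open>Hom groups and the categorical notions that they detect\<close>

context preadditive_category
begin

lemma preadditive_op: "preadditive_category (op_cat C) (\<lambda>X Y. G Y X)"
  by (intro preadditive_category.intro preadditive_category_axioms.intro category_op)
    (auto simp: hom_group hom_carrier Cmp_add_left Cmp_add_right)

lemma hom_zero: "\<lbrakk>X \<in> Ob C; Y \<in> Ob C\<rbrakk> \<Longrightarrow> \<zero>\<^bsub>G X Y\<^esub> \<in> Hom C X Y"
  using hom_group hom_carrier abelian_group.axioms(1) abelian_monoid.zero_closed by metis

lemma hom_add: "\<lbrakk>X \<in> Ob C; Y \<in> Ob C; f \<in> Hom C X Y; g \<in> Hom C X Y\<rbrakk> \<Longrightarrow> f \<oplus>\<^bsub>G X Y\<^esub> g \<in> Hom C X Y"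
  using hom_group hom_carrier abelian_group.axioms(1) abelian_monoid.a_closed by metis

lemma hom_minus: "\<lbrakk>X \<in> Ob C; Y \<in> Ob C; f \<in> Hom C X Y\<rbrakk> \<Longrightarrow> \<ominus>\<^bsub>G X Y\<^esub> f \<in> Hom C X Y"
  using hom_group hom_carrier abelian_group.a_inv_closed by metis

text \<open>By additivity the composite added to itself is itself, and cancellation in the hom group
  makes it zero.\<close>

lemma Cmp_zero_left:
  assumes "X \<in> Ob C" "Y \<in> Ob C" "Z \<in> Ob C" "f \<in> Hom C X Y"
  shows "Cmp C X Y Z \<zero>\<^bsub>G Y Z\<^esub> f = \<zero>\<^bsub>G X Z\<^esub>"
proof -
  interpret YZ: abelian_group "G Y Z" using hom_group assms by blast
  interpret XZ: abelian_group "G X Z" using hom_group assms by blast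
  have z: "\<zero>\<^bsub>G Y Z\<^esub> \<in> Hom C Y Z" using hom_zero assms by blast
  then have "Cmp C X Y Z \<zero>\<^bsub>G Y Z\<^esub> f \<in> carrier (G X Z)" using Cmp_in_Hom assms hom_carrier by blast
  moreover have "Cmp C X Y Z \<zero>\<^bsub>G Y Z\<^esub> f \<oplus>\<^bsub>G X Z\<^esub> Cmp C X Y Z \<zero>\<^bsub>G Y Z\<^esub> f = Cmp C X Y Z \<zero>\<^bsub>G Y Z\<^esub> f"
    using Cmp_add_left[OF assms z z] by simp
  ultimately show ?thesis by (simp add: XZ.add.r_cancel_one)
qed

lemma Cmp_zero_right:
  assumes "X \<in> Ob C" "Y \<in> Ob C" "Z \<in> Ob C" "g \<in> Hom C Y Z"
  shows "Cmp C X Y Z g \<zero>\<^bsub>G X Y\<^esub> = \<zero>\<^bsub>G X Z\<^esub>"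
  using preadditive_category.Cmp_zero_left[OF preadditive_op, of Z Y X g] assms by simp

text \<open>A map out of a zero object is unique, hence is the zero of its hom group, and composites
  with zero are zero. This trades a notion that mentions no group for an equation that additive
  arguments can use.\<close>

lemma is_zero_mor_iff:
  assumes "is_zero_object C Z" "X \<in> Ob C" "Y \<in> Ob C"
  shows "is_zero_mor C X Y h \<longleftrightarrow> h = \<zero>\<^bsub>G X Y\<^esub>"
proof
  have Z: "Z \<in> Ob C" and U: "\<And>W f f'. \<lbrakk>W \<in> Ob C; f \<in> Hom C Z W; f' \<in> Hom C Z W\<rbrakk> \<Longrightarrow> f = f'"
    using assms(1) by (auto simp: is_zero_object_def)
  show "h = \<zero>\<^bsub>G X Y\<^esub>" if h: "is_zero_mor C X Y h"
  proof -
    obtain f g where fg: "f \<in> Hom C X Z" "g \<in> Hom C Z Y" "h = Cmp C X Z Y g f"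
      using zero_mor_factor[OF assms(1) h assms(2,3)] by blast
    moreover have "g = \<zero>\<^bsub>G Z Y\<^esub>" using U[OF assms(3) fg(2) hom_zero[OF Z assms(3)]] .
    ultimately show ?thesis using Cmp_zero_left Z assms by simp
  qed
  show "is_zero_mor C X Y h" if "h = \<zero>\<^bsub>G X Y\<^esub>"
    unfolding is_zero_mor_def
    using that assms Z hom_zero Cmp_zero_left by metis
qed

text \<open>If \<open>f\<close> identifies \<open>u\<close> and \<open>v\<close>, then it kills
  their difference.\<close>

lemma is_monoI:
  assumes X: "X \<in> Ob C" and Y: "Y \<in> Ob C" and f: "f \<in> Hom C X Y"
    and ker: "\<And>W u. \<lbrakk>W \<in> Ob C; u \<in> Hom C W X; Cmp C W X Y f u = \<zero>\<^bsub>G W Y\<^esub>\<rbrakk> \<Longrightarrow> u = \<zero>\<^bsub>G W X\<^esub>"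
  shows "is_mono C X Y f"
  unfolding is_mono_def
proof (intro conjI ballI impI X Y f)
  fix W u v
  assume W: "W \<in> Ob C" and u: "u \<in> Hom C W X" and v: "v \<in> Hom C W X"
    and eq: "Cmp C W X Y f u = Cmp C W X Y f v"
  interpret WX: abelian_group "G W X" using hom_group W X by blast
  interpret WY: abelian_group "G W Y" using hom_group W Y by blast
  have mv: "\<ominus>\<^bsub>G W X\<^esub> v \<in> Hom C W X" using hom_minus W X v by blast
  have "Cmp C W X Y f (u \<oplus>\<^bsub>G W X\<^esub> \<ominus>\<^bsub>G W X\<^esub> v) = Cmp C W X Y f v \<oplus>\<^bsub>G W Y\<^esub> Cmp C W X Y f (\<ominus>\<^bsub>G W X\<^esub> v)"
    using Cmp_add_right[OF W X Y u mv f] eq by simp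
  also have "\<dots> = Cmp C W X Y f (v \<oplus>\<^bsub>G W X\<^esub> \<ominus>\<^bsub>G W X\<^esub> v)"
    using Cmp_add_right[OF W X Y v mv f] by simp
  also have "\<dots> = \<zero>\<^bsub>G W Y\<^esub>"
    using Cmp_zero_right W X Y f v hom_carrier WX.r_neg by metis
  finally have "u \<oplus>\<^bsub>G W X\<^esub> \<ominus>\<^bsub>G W X\<^esub> v = \<zero>\<^bsub>G W X\<^esub>"
    using ker W hom_add W X u mv by blast
  then show "u = v"
    using u v hom_carrier W X WX.minus_equality WX.minus_minus WX.a_inv_closed by metis
qed

lemma is_kernel_iff:
  assumes "is_zero_object C Z"
  shows "is_kernel C X Y f K k \<longleftrightarrow>
     X \<in> Ob C \<and> Y \<in> Ob C \<and> f \<in> Hom C X Y \<and> K \<in> Ob C \<and> k \<in> Hom C K X \<and>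
     Cmp C K X Y f k = \<zero>\<^bsub>G K Y\<^esub> \<and>
     (\<forall>W\<in>Ob C. \<forall>h\<in>Hom C W X. Cmp C W X Y f h = \<zero>\<^bsub>G W Y\<^esub> \<longrightarrow>
        (\<exists>!u. u \<in> Hom C W K \<and> Cmp C W K X k u = h))"
  unfolding is_kernel_def using is_zero_mor_iff[OF assms] by blast

end

section \<open>Self-dual exactness axioms and left exact functors\<close>

locale preabelian_category = preadditive_category C G
  for C :: "('o, 'm, 'z) cat_scheme" and G +
  assumes ex_zero_object: "\<exists>Z. is_zero_object C Z"
    and ex_kernel: "\<lbrakk>X \<in> Ob C; Y \<in> Ob C; f \<in> Hom C X Y\<rbrakk> \<Longrightarrow> \<exists>K k. is_kernel C X Y f K k"
    and ex_cokernel: "\<lbrakk>X \<in> Ob C; Y \<in> Ob C; f \<in> Hom C X Y\<rbrakk> \<Longrightarrow> \<exists>Q q. is_cokernel C X Y f Q q"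
    and mono_is_kernel: "is_mono C X Y m \<Longrightarrow> \<exists>Z f. is_kernel C Y Z f X m"
    and epi_is_cokernel: "is_epi C X Y e \<Longrightarrow> \<exists>W f. is_cokernel C W X f Y e"
begin

text \<open>Products are kept out of the locale so that its axioms are self-dual: kernels trade
  places with cokernels and monomorphisms with epimorphisms, and no coproduct has to be
  constructed.\<close>

lemma preabelian_op: "preabelian_category (op_cat C) (\<lambda>X Y. G Y X)"
  using ex_zero_object ex_kernel ex_cokernel mono_is_kernel epi_is_cokernel
  by (intro preabelian_category.intro preabelian_category_axioms.intro preadditive_op)
    (auto simp: is_cokernel_def is_epi_def)

lemma kernelD:
  assumes "is_kernel C X Y f K k"
  shows "X \<in> Ob C" "Y \<in> Ob C" "f \<in> Hom C X Y" "K \<in> Ob C" "k \<in> Hom C K X"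
    "Cmp C K X Y f k = \<zero>\<^bsub>G K Y\<^esub>"
    "\<And>W h. \<lbrakk>W \<in> Ob C; h \<in> Hom C W X; Cmp C W X Y f h = \<zero>\<^bsub>G W Y\<^esub>\<rbrakk> \<Longrightarrow>
        \<exists>!u. u \<in> Hom C W K \<and> Cmp C W K X k u = h"
  using ex_zero_object assms is_kernel_iff by blast+

lemma cokernelD:
  assumes "is_cokernel C X Y f Q q"
  shows "X \<in> Ob C" "Y \<in> Ob C" "f \<in> Hom C X Y" "Q \<in> Ob C" "q \<in> Hom C Y Q"
    "Cmp C X Y Q q f = \<zero>\<^bsub>G X Q\<^esub>"
    "\<And>W h. \<lbrakk>W \<in> Ob C; h \<in> Hom C Y W; Cmp C X Y W h f = \<zero>\<^bsub>G X W\<^esub>\<rbrakk> \<Longrightarrow>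
        \<exists>!u. u \<in> Hom C Q W \<and> Cmp C Y Q W u q = h"
  using preabelian_category.kernelD[OF preabelian_op, of Y X f Q q] assms
  by (simp_all add: is_cokernel_def)

text \<open>Say \<open>m\<close> is a kernel of some \<open>f\<close>. Then \<open>f\<close> kills
  \<open>m\<close> and so factors through the cokernel \<open>q\<close>. Whatever \<open>q\<close>
  kills is therefore killed by \<open>f\<close>, and it lifts uniquely through
  \<open>m\<close>.\<close>

lemma mono_kernel_of_cokernel:
  assumes m: "is_mono C X Y m" and q: "is_cokernel C X Y m Q q"
  shows "is_kernel C Y Q q X m"
proof -
  obtain Z where Z: "is_zero_object C Z" using ex_zero_object by blast
  obtain V f where f: "is_kernel C Y V f X m" using mono_is_kernel[OF m] by blast
  note F = kernelD[OF f] and Q = cokernelD[OF q]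
  obtain t where t: "t \<in> Hom C Q V" "Cmp C Y Q V t q = f" using Q(7)[OF F(2,3,6)] by blast
  have "Cmp C W Y V f h = \<zero>\<^bsub>G W V\<^esub>"
    if "W \<in> Ob C" "h \<in> Hom C W Y" "Cmp C W Y Q q h = \<zero>\<^bsub>G W Q\<^esub>" for W h
    using Cmp_assoc[of W Y Q V h q t] Cmp_zero_right[of W Q V t] that t Q F by simp
  then show ?thesis
    unfolding is_kernel_iff[OF Z] using F Q by blast
qed

lemma epi_cokernel_of_kernel:
  assumes "is_epi C X Y e" "is_kernel C X Y e K k"
  shows "is_cokernel C K X k Y e"
  using preabelian_category.mono_kernel_of_cokernel[OF preabelian_op, of Y X e K k] assms
  by (simp add: is_epi_def is_cokernel_def)

end


text \<open>For each \<open>i\<close> this is an additive left exact functor from \<open>C\<close>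
  to abelian groups. The index runs through the objects of the other category, so that all the
  \<open>M(A, -)\<close> form one such family on \<B>, and all the \<open>M(-, B)\<close> form one
  on the opposite of \<A>.\<close>

locale exact_family = preabelian_category C G
  for C :: "('o, 'm, 'z) cat_scheme" and G +
  fixes I :: "'i set" and N :: "'i \<Rightarrow> 'o \<Rightarrow> ('r, 'x) module"
    and act :: "'i \<Rightarrow> 'o \<Rightarrow> 'o \<Rightarrow> 'm \<Rightarrow> 'x \<Rightarrow> 'x"
  assumes N_group: "\<lbrakk>i \<in> I; X \<in> Ob C\<rbrakk> \<Longrightarrow> abelian_group (N i X)"
    and act_closed: "\<lbrakk>i \<in> I; X \<in> Ob C; Y \<in> Ob C; f \<in> Hom C X Y; x \<in> carrier (N i X)\<rbrakk>
      \<Longrightarrow> act i X Y f x \<in> carrier (N i Y)"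
    and act_add: "\<lbrakk>i \<in> I; X \<in> Ob C; Y \<in> Ob C; f \<in> Hom C X Y; x \<in> carrier (N i X); y \<in> carrier (N i X)\<rbrakk>
      \<Longrightarrow> act i X Y f (x \<oplus>\<^bsub>N i X\<^esub> y) = act i X Y f x \<oplus>\<^bsub>N i Y\<^esub> act i X Y f y"
    and act_add_mor: "\<lbrakk>i \<in> I; X \<in> Ob C; Y \<in> Ob C; f \<in> Hom C X Y; g \<in> Hom C X Y; x \<in> carrier (N i X)\<rbrakk>
      \<Longrightarrow> act i X Y (f \<oplus>\<^bsub>G X Y\<^esub> g) x = act i X Y f x \<oplus>\<^bsub>N i Y\<^esub> act i X Y g x"
    and act_Idn: "\<lbrakk>i \<in> I; X \<in> Ob C; x \<in> carrier (N i X)\<rbrakk> \<Longrightarrow> act i X X (Idn C X) x = x"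
    and act_Cmp: "\<lbrakk>i \<in> I; X \<in> Ob C; Y \<in> Ob C; Z \<in> Ob C; f \<in> Hom C X Y; g \<in> Hom C Y Z; x \<in> carrier (N i X)\<rbrakk>
      \<Longrightarrow> act i X Z (Cmp C X Y Z g f) x = act i Y Z g (act i X Y f x)"
    and act_exact: "i \<in> I \<Longrightarrow> left_exact C (N i) (act i)"
begin

lemma N_zero: "\<lbrakk>i \<in> I; X \<in> Ob C\<rbrakk> \<Longrightarrow> \<zero>\<^bsub>N i X\<^esub> \<in> carrier (N i X)"
  using N_group abelian_group.axioms(1) abelian_monoid.zero_closed by metis

lemma act_zero:
  assumes "i \<in> I" "X \<in> Ob C" "Y \<in> Ob C" "f \<in> Hom C X Y"
  shows "act i X Y f \<zero>\<^bsub>N i X\<^esub> = \<zero>\<^bsub>N i Y\<^esub>"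
proof -
  interpret X: abelian_group "N i X" using N_group assms by blast
  interpret Y: abelian_group "N i Y" using N_group assms by blast
  show ?thesis
    using act_add[OF assms X.zero_closed X.zero_closed] act_closed[OF assms X.zero_closed]
    by (simp add: Y.add.r_cancel_one)
qed

lemma act_zero_mor:
  assumes "i \<in> I" "X \<in> Ob C" "Y \<in> Ob C" "x \<in> carrier (N i X)"
  shows "act i X Y \<zero>\<^bsub>G X Y\<^esub> x = \<zero>\<^bsub>N i Y\<^esub>"
proof -
  interpret XY: abelian_group "G X Y" using hom_group assms by blast
  interpret Y: abelian_group "N i Y" using N_group assms by blast
  have z: "\<zero>\<^bsub>G X Y\<^esub> \<in> Hom C X Y" using hom_zero assms by blast
  show ?thesis
    using act_add_mor[OF assms(1-3) z z assms(4)] act_closed[OF assms(1-3) z assms(4)]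
    by (simp add: Y.add.r_cancel_one)
qed

lemma act_minus_mor:
  assumes "i \<in> I" "X \<in> Ob C" "Y \<in> Ob C" "f \<in> Hom C X Y" "x \<in> carrier (N i X)"
  shows "act i X Y (\<ominus>\<^bsub>G X Y\<^esub> f) x = \<ominus>\<^bsub>N i Y\<^esub> act i X Y f x"
proof -
  interpret XY: abelian_group "G X Y" using hom_group assms by blast
  interpret Y: abelian_group "N i Y" using N_group assms by blast
  have m: "\<ominus>\<^bsub>G X Y\<^esub> f \<in> Hom C X Y" using hom_minus assms by blast
  have "act i X Y (\<ominus>\<^bsub>G X Y\<^esub> f) x \<oplus>\<^bsub>N i Y\<^esub> act i X Y f x = \<zero>\<^bsub>N i Y\<^esub>"
    using act_add_mor[OF assms(1-3) m assms(4,5)] act_zero_mor assms hom_carrier XY.l_neg by metis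
  then show ?thesis using Y.minus_equality act_closed assms m by metis
qed

text \<open>Left exactness is split into uniqueness of lifts along a kernel, here, and their
  existence, in \<open>act_kernel_lift\<close>.\<close>

lemma act_kernel_inj:
  assumes "is_kernel C Y Z g X f" "i \<in> I" "x \<in> carrier (N i X)" "y \<in> carrier (N i X)"
    "act i X Y f x = act i X Y f y"
  shows "x = y"
  using act_exact[OF assms(2)] assms unfolding left_exact_def by (blast dest: inj_onD)

lemma act_kernel_lift:
  assumes "is_kernel C Y Z g X f" "i \<in> I" "y \<in> carrier (N i Y)" "act i Y Z g y = \<zero>\<^bsub>N i Z\<^esub>"
  obtains x where "x \<in> carrier (N i X)" "act i X Y f x = y"
  using act_exact[OF assms(2)] assms unfolding left_exact_def by (blast elim: imageE dest: equalityD2)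

end

section \<open>The gluing, described symmetrically in its two sides\<close>

text \<open>
  \<open>A\<close> plays the role of \<open>\<A>\<^sup>o\<^sup>p\<close>, so the first component of a morphism of \<open>D\<close> goes backwards in \<open>A\<close>.
  That \<open>D\<close> is described by arbitrary constructors \<open>obj\<close> and \<open>mor\<close> is what lets the opposite of \<open>D\<close>
  be an instance again.
\<close>

locale gluing =
  A: exact_family A GA "Ob B" "\<lambda>b a. N a b" actA + B: exact_family B GB "Ob A" N actB
  for A :: "('a, 'ma, 'za) cat_scheme" and GA and B :: "('b, 'mb, 'zb) cat_scheme" and GB
    and N :: "'a \<Rightarrow> 'b \<Rightarrow> ('r, 'x) module" and actA and actB +
  fixes D :: "('o, 'm, 'z) cat_scheme" and obj :: "'a \<Rightarrow> 'b \<Rightarrow> 'x \<Rightarrow> 'o" and mor :: "'ma \<Rightarrow> 'mb \<Rightarrow> 'm"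
  assumes act_commute: "\<lbrakk>a \<in> Ob A; a' \<in> Ob A; b \<in> Ob B; b' \<in> Ob B; f \<in> Hom A a a'; g \<in> Hom B b b';
        x \<in> carrier (N a b)\<rbrakk>
      \<Longrightarrow> actB a' b b' g (actA b a a' f x) = actA b' a a' f (actB a b b' g x)"
    and Ob_D: "Ob D = {obj a b x |a b x. a \<in> Ob A \<and> b \<in> Ob B \<and> x \<in> carrier (N a b)}"
    and Hom_D: "\<lbrakk>a \<in> Ob A; b \<in> Ob B; x \<in> carrier (N a b); a' \<in> Ob A; b' \<in> Ob B; x' \<in> carrier (N a' b')\<rbrakk>
      \<Longrightarrow> Hom D (obj a b x) (obj a' b' x') = {mor f g |f g. f \<in> Hom A a' a \<and> g \<in> Hom B b b' \<and>
          actB a b b' g x = actA b' a' a f x'}"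
    and Idn_D: "Idn D (obj a b x) = mor (Idn A a) (Idn B b)"
    and Cmp_D: "Cmp D (obj a b x) (obj a' b' x') (obj a'' b'' x'') (mor f' g') (mor f g) =
          mor (Cmp A a'' a' a f f') (Cmp B b b' b'' g' g)"
    and mor_inject: "mor f g = mor f' g' \<longleftrightarrow> f = f' \<and> g = g'"
begin

lemma obj_in_Ob: "\<lbrakk>a \<in> Ob A; b \<in> Ob B; x \<in> carrier (N a b)\<rbrakk> \<Longrightarrow> obj a b x \<in> Ob D"
  using Ob_D by blast

lemma ball_Ob_D: "(\<forall>X\<in>Ob D. P X) \<longleftrightarrow> (\<forall>a\<in>Ob A. \<forall>b\<in>Ob B. \<forall>x\<in>carrier (N a b). P (obj a b x))"
  by (auto simp: Ob_D)

lemma Ob_D_cases: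
  assumes "X \<in> Ob D"
  obtains a b x where "X = obj a b x" "a \<in> Ob A" "b \<in> Ob B" "x \<in> carrier (N a b)"
  using assms Ob_D by blast

lemma mor_in_Hom:
  "\<lbrakk>a \<in> Ob A; b \<in> Ob B; x \<in> carrier (N a b); a' \<in> Ob A; b' \<in> Ob B; x' \<in> carrier (N a' b')\<rbrakk>
    \<Longrightarrow> mor f g \<in> Hom D (obj a b x) (obj a' b' x') \<longleftrightarrow>
        f \<in> Hom A a' a \<and> g \<in> Hom B b b' \<and> actB a b b' g x = actA b' a' a f x'"
  by (simp add: Hom_D mor_inject)

lemma Hom_D_cases:
  assumes "h \<in> Hom D (obj a b x) (obj a' b' x')"
    "a \<in> Ob A" "b \<in> Ob B" "x \<in> carrier (N a b)" "a' \<in> Ob A" "b' \<in> Ob B" "x' \<in> carrier (N a' b')"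
  obtains f g where "h = mor f g" "f \<in> Hom A a' a" "g \<in> Hom B b b'" "actB a b b' g x = actA b' a' a f x'"
  using assms Hom_D by blast

text \<open>Exchanging the two sides reverses the arrows of both components, and the matching
  condition is then the same equation read from right to left. The interchange law
  \<open>act_commute\<close> is symmetric as well.\<close>

lemma dual: "gluing B GB A GA (\<lambda>b a. N a b) actB actA (op_cat D) (\<lambda>b a. obj a b) (\<lambda>g f. mor f g)"
  by (intro gluing.intro gluing_axioms.intro A.exact_family_axioms B.exact_family_axioms)
    (auto simp: Ob_D Hom_D Idn_D Cmp_D mor_inject act_commute[symmetric])

lemma Cmp_in_Hom_D:
  assumes "X \<in> Ob D" "Y \<in> Ob D" "Z \<in> Ob D" "h \<in> Hom D X Y" "k \<in> Hom D Y Z"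
  shows "Cmp D X Y Z k h \<in> Hom D X Z"
proof -
  obtain a b x where X: "X = obj a b x" "a \<in> Ob A" "b \<in> Ob B" "x \<in> carrier (N a b)"
    using assms(1) by (rule Ob_D_cases)
  obtain a' b' x' where Y: "Y = obj a' b' x'" "a' \<in> Ob A" "b' \<in> Ob B" "x' \<in> carrier (N a' b')"
    using assms(2) by (rule Ob_D_cases)
  obtain a'' b'' x'' where Z: "Z = obj a'' b'' x''" "a'' \<in> Ob A" "b'' \<in> Ob B" "x'' \<in> carrier (N a'' b'')"
    using assms(3) by (rule Ob_D_cases)
  obtain f g where h: "h = mor f g" "f \<in> Hom A a' a" "g \<in> Hom B b b'" "actB a b b' g x = actA b' a' a f x'"
    using assms(4) X Y by (auto elim: Hom_D_cases)
  obtain f' g' where k: "k = mor f' g'" "f' \<in> Hom A a'' a'" "g' \<in> Hom B b' b''"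
    "actB a' b' b'' g' x' = actA b'' a'' a' f' x''"
    using assms(5) Y Z by (auto elim: Hom_D_cases)
  \<comment> \<open>The two matching conditions are chained through the middle element
    \<open>x'\<close>: the one for \<open>h\<close> brings it in, the interchange law moves
    \<open>g'\<close> past \<open>f\<close>, and the one for \<open>k\<close> removes it.\<close>
  have "actB a b b'' (Cmp B b b' b'' g' g) x = actB a b' b'' g' (actA b' a' a f x')"
    using B.act_Cmp X Y Z h k by simp
  also have "\<dots> = actA b'' a' a f (actA b'' a'' a' f' x'')"
    using act_commute[OF Y(2) X(2) Y(3) Z(3) h(2) k(3) Y(4)] k by simp
  also have "\<dots> = actA b'' a'' a (Cmp A a'' a' a f f') x''"
    using A.act_Cmp X Y Z h k by simp
  finally show ?thesis
    using X Y Z h k by (simp add: Cmp_D mor_in_Hom A.Cmp_in_Hom B.Cmp_in_Hom)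
qed

sublocale category D
proof
  fix X assume "X \<in> Ob D"
  then show "Idn D X \<in> Hom D X X"
    by (elim Ob_D_cases)
      (simp add: mor_in_Hom Idn_D A.Idn_in_Hom B.Idn_in_Hom A.act_Idn B.act_Idn)
next
  fix X Y Z f g
  assume "X \<in> Ob D" "Y \<in> Ob D" "Z \<in> Ob D" "f \<in> Hom D X Y" "g \<in> Hom D Y Z"
  then show "Cmp D X Y Z g f \<in> Hom D X Z"
    by (rule Cmp_in_Hom_D)
next
  fix X Y h
  assume "X \<in> Ob D" "Y \<in> Ob D" and h: "h \<in> Hom D X Y"
  then obtain a b x a' b' x' where X: "X = obj a b x" "a \<in> Ob A" "b \<in> Ob B" "x \<in> carrier (N a b)"
    and Y: "Y = obj a' b' x'" "a' \<in> Ob A" "b' \<in> Ob B" "x' \<in> carrier (N a' b')"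
    by (metis Ob_D_cases)
  obtain f g where "h = mor f g" "f \<in> Hom A a' a" "g \<in> Hom B b b'"
    using h unfolding X(1) Y(1) by (rule Hom_D_cases[OF _ X(2-4) Y(2-4)])
  then show "Cmp D X Y Y (Idn D Y) h = h" "Cmp D X X Y h (Idn D X) = h"
    using X Y by (simp_all add: Idn_D Cmp_D A.Cmp_Idn_left B.Cmp_Idn_left A.Cmp_Idn_right B.Cmp_Idn_right)
next
  fix W X Y Z h k l
  assume Ob: "W \<in> Ob D" "X \<in> Ob D" "Y \<in> Ob D" "Z \<in> Ob D"
    and Hom: "h \<in> Hom D W X" "k \<in> Hom D X Y" "l \<in> Hom D Y Z"
  obtain a b x where W: "W = obj a b x" "a \<in> Ob A" "b \<in> Ob B" "x \<in> carrier (N a b)"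
    using Ob(1) by (rule Ob_D_cases)
  obtain a' b' x' where X: "X = obj a' b' x'" "a' \<in> Ob A" "b' \<in> Ob B" "x' \<in> carrier (N a' b')"
    using Ob(2) by (rule Ob_D_cases)
  obtain a'' b'' x'' where Y: "Y = obj a'' b'' x''" "a'' \<in> Ob A" "b'' \<in> Ob B" "x'' \<in> carrier (N a'' b'')"
    using Ob(3) by (rule Ob_D_cases)
  obtain c d y where Z: "Z = obj c d y" "c \<in> Ob A" "d \<in> Ob B" "y \<in> carrier (N c d)"
    using Ob(4) by (rule Ob_D_cases)
  obtain f g where "h = mor f g" "f \<in> Hom A a' a" "g \<in> Hom B b b'"
    using Hom(1) unfolding W(1) X(1) by (rule Hom_D_cases[OF _ W(2-4) X(2-4)])
  moreover obtain f' g' where "k = mor f' g'" "f' \<in> Hom A a'' a'" "g' \<in> Hom B b' b''"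
    using Hom(2) unfolding X(1) Y(1) by (rule Hom_D_cases[OF _ X(2-4) Y(2-4)])
  moreover obtain f'' g'' where "l = mor f'' g''" "f'' \<in> Hom A c a''" "g'' \<in> Hom B b'' d"
    using Hom(3) unfolding Y(1) Z(1) by (rule Hom_D_cases[OF _ Y(2-4) Z(2-4)])
  ultimately show "Cmp D W Y Z l (Cmp D W X Y k h) = Cmp D W X Z (Cmp D X Y Z l k) h"
    using W X Y Z by (simp add: Cmp_D A.Cmp_assoc B.Cmp_assoc)
qed

section \<open>Zero morphisms and kernels in the gluing\<close>

lemma zero_object_D:
  assumes z: "is_zero_object A z" and w: "is_zero_object B w"
  shows "is_zero_object D (obj z w \<zero>\<^bsub>N z w\<^esub>)"
proof -
  have Ob: "z \<in> Ob A" "w \<in> Ob B" using assms by (auto simp: is_zero_object_def)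
  note Z = B.N_zero[OF Ob]
  have "(\<exists>!h. h \<in> Hom D (obj a b x) (obj z w \<zero>\<^bsub>N z w\<^esub>)) \<and>
      (\<exists>!h. h \<in> Hom D (obj z w \<zero>\<^bsub>N z w\<^esub>) (obj a b x))"
    if X: "a \<in> Ob A" "b \<in> Ob B" "x \<in> carrier (N a b)" for a b x
  proof (intro conjI)
    have A1: "\<And>f. f \<in> Hom A z a \<longleftrightarrow> f = \<zero>\<^bsub>GA z a\<^esub>" "\<And>f. f \<in> Hom A a z \<longleftrightarrow> f = \<zero>\<^bsub>GA a z\<^esub>"
      using z X A.hom_zero Ob unfolding is_zero_object_def by blast+
    have B1: "\<And>f. f \<in> Hom B w b \<longleftrightarrow> f = \<zero>\<^bsub>GB w b\<^esub>" "\<And>f. f \<in> Hom B b w \<longleftrightarrow> f = \<zero>\<^bsub>GB b w\<^esub>"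
      using w X B.hom_zero Ob unfolding is_zero_object_def by blast+
    show "\<exists>!h. h \<in> Hom D (obj a b x) (obj z w \<zero>\<^bsub>N z w\<^esub>)"
      using X Ob Z A1 B1
      by (auto simp: Hom_D mor_inject A.act_zero B.act_zero_mor)
    show "\<exists>!h. h \<in> Hom D (obj z w \<zero>\<^bsub>N z w\<^esub>) (obj a b x)"
      using X Ob Z A1 B1
      by (auto simp: Hom_D mor_inject B.act_zero A.act_zero_mor)
  qed
  then show ?thesis
    using obj_in_Ob Ob Z by (simp add: is_zero_object_def ball_Ob_D)
qed

lemma ex_zero_object_D: "\<exists>Z. is_zero_object D Z"
  using A.ex_zero_object B.ex_zero_object zero_object_D by blast

text \<open>\<open>D\<close> has no group structure at this point, so zero morphisms are computed
  from their factorization. Through the explicit zero object \<open>?z\<close> there is only one,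
  because the hom-sets into and out of \<open>?z\<close> are singletons.\<close>

lemma is_zero_mor_D:
  assumes X: "a \<in> Ob A" "b \<in> Ob B" "x \<in> carrier (N a b)"
    and X': "a' \<in> Ob A" "b' \<in> Ob B" "x' \<in> carrier (N a' b')"
  shows "is_zero_mor D (obj a b x) (obj a' b' x') (mor f g) \<longleftrightarrow> f = \<zero>\<^bsub>GA a' a\<^esub> \<and> g = \<zero>\<^bsub>GB b b'\<^esub>"
proof -
  obtain z w where z: "is_zero_object A z" and w: "is_zero_object B w"
    using A.ex_zero_object B.ex_zero_object by blast
  have Ob: "z \<in> Ob A" "w \<in> Ob B" using z w by (auto simp: is_zero_object_def)
  note Z = B.N_zero[OF Ob]
  note zD = zero_object_D[OF z w]
  let ?z = "obj z w \<zero>\<^bsub>N z w\<^esub>"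
  let ?in = "mor \<zero>\<^bsub>GA z a\<^esub> \<zero>\<^bsub>GB b w\<^esub>" and ?out = "mor \<zero>\<^bsub>GA a' z\<^esub> \<zero>\<^bsub>GB w b'\<^esub>"
  have "Cmp A a' z a \<zero>\<^bsub>GA z a\<^esub> \<zero>\<^bsub>GA a' z\<^esub> = \<zero>\<^bsub>GA a' a\<^esub>" "Cmp B b w b' \<zero>\<^bsub>GB w b'\<^esub> \<zero>\<^bsub>GB b w\<^esub> = \<zero>\<^bsub>GB b b'\<^esub>"
    using Ob X X' by (simp_all add: A.Cmp_zero_left B.Cmp_zero_left A.hom_zero B.hom_zero)
  then have c: "Cmp D (obj a b x) ?z (obj a' b' x') ?out ?in = mor \<zero>\<^bsub>GA a' a\<^esub> \<zero>\<^bsub>GB b b'\<^esub>"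
    by (simp add: Cmp_D)
  have "?in \<in> Hom D (obj a b x) ?z"
    using X Ob Z A.hom_zero B.hom_zero by (simp add: mor_in_Hom A.act_zero B.act_zero_mor)
  then have inn: "h \<in> Hom D (obj a b x) ?z \<longleftrightarrow> h = ?in" for h
    using zD obj_in_Ob[OF X] unfolding is_zero_object_def by blast
  have "?out \<in> Hom D ?z (obj a' b' x')"
    using X' Ob Z A.hom_zero B.hom_zero by (simp add: mor_in_Hom B.act_zero A.act_zero_mor)
  then have out: "h \<in> Hom D ?z (obj a' b' x') \<longleftrightarrow> h = ?out" for h
    using zD obj_in_Ob[OF X'] unfolding is_zero_object_def by blast
  have "is_zero_mor D (obj a b x) (obj a' b' x') h \<longleftrightarrow> h = mor \<zero>\<^bsub>GA a' a\<^esub> \<zero>\<^bsub>GB b b'\<^esub>" for h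
  proof
    assume "is_zero_mor D (obj a b x) (obj a' b' x') h"
    then show "h = mor \<zero>\<^bsub>GA a' a\<^esub> \<zero>\<^bsub>GB b b'\<^esub>"
      using zero_mor_factor[OF zD _ obj_in_Ob[OF X] obj_in_Ob[OF X']] inn out c by metis
  next
    assume "h = mor \<zero>\<^bsub>GA a' a\<^esub> \<zero>\<^bsub>GB b b'\<^esub>"
    then show "is_zero_mor D (obj a b x) (obj a' b' x') h"
      unfolding is_zero_mor_def using zD inn out c by metis
  qed
  then show ?thesis by (simp add: mor_inject)
qed

text \<open>The first component runs backwards, so a kernel in \<open>D\<close> needs a cokernel in
  \<open>A\<close>. The universal properties of the two components already give a unique pair
  \<open>(u', v')\<close>. What remains is that this pair satisfies the matching condition, and the
  injectivity of the action of the kernel \<open>m\<close> decides that.\<close>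

lemma is_kernel_D:
  assumes X: "a \<in> Ob A" "b \<in> Ob B" "x \<in> carrier (N a b)"
    and X': "a' \<in> Ob A" "b' \<in> Ob B" "x' \<in> carrier (N a' b')"
    and h: "mor f g \<in> Hom D (obj a b x) (obj a' b' x')"
    and k: "is_cokernel A a' a f c k" and m: "is_kernel B b b' g l m"
    and y: "y \<in> carrier (N c l)" and y_eq: "actB c l b m y = actA b a c k x"
  shows "is_kernel D (obj a b x) (obj a' b' x') (mor f g) (obj c l y) (mor k m)"
proof -
  note kD = A.cokernelD[OF k] and mD = B.kernelD[OF m]
  have K: "c \<in> Ob A" "l \<in> Ob B" by fact+
  have km: "mor k m \<in> Hom D (obj c l y) (obj a b x)"
    using X K y y_eq kD mD by (simp add: mor_in_Hom)
  have comp: "is_zero_mor D (obj c l y) (obj a' b' x')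
      (Cmp D (obj c l y) (obj a b x) (obj a' b' x') (mor f g) (mor k m))"
    using X' K y kD mD by (simp add: Cmp_D is_zero_mor_D)
  have univ: "\<exists>!t. t \<in> Hom D (obj d e w) (obj c l y) \<and>
      Cmp D (obj d e w) (obj c l y) (obj a b x) (mor k m) t = t'"
    if W: "d \<in> Ob A" "e \<in> Ob B" "w \<in> carrier (N d e)" and t': "t' \<in> Hom D (obj d e w) (obj a b x)"
      and z: "is_zero_mor D (obj d e w) (obj a' b' x') (Cmp D (obj d e w) (obj a b x) (obj a' b' x') (mor f g) t')"
    for d e w t'
  proof -
    obtain u v where t'_eq: "t' = mor u v" and u: "u \<in> Hom A a d" and v: "v \<in> Hom B e b"
      and uv: "actB d e b v w = actA b a d u x"
      using Hom_D_cases[OF t' W X] by blast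
    have "Cmp A a' a d u f = \<zero>\<^bsub>GA a' d\<^esub>" "Cmp B e b b' g v = \<zero>\<^bsub>GB e b'\<^esub>"
      using z W X' by (simp_all add: t'_eq Cmp_D is_zero_mor_D)
    then have u1: "\<exists>!u'. u' \<in> Hom A c d \<and> Cmp A a c d u' k = u"
      and v1: "\<exists>!v'. v' \<in> Hom B e l \<and> Cmp B e l b m v' = v"
      using kD(7)[OF W(1) u] mD(7)[OF W(2) v] by blast+
    obtain u' where u': "u' \<in> Hom A c d" "Cmp A a c d u' k = u" using u1 by blast
    obtain v' where v': "v' \<in> Hom B e l" "Cmp B e l b m v' = v" using v1 by blast
    have cl: "actB d e l v' w \<in> carrier (N d l)" "actA l c d u' y \<in> carrier (N d l)"
      using A.act_closed B.act_closed W K y u' v' by blast+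
    \<comment> \<open>Both sides of the matching condition are compared after applying
      \<open>m\<close>. Each becomes the image of \<open>x\<close> under \<open>u\<close>: one by
      the condition on \<open>t'\<close>, the other by \<open>y_eq\<close> and the interchange
      law.\<close>
    have "actB d l b m (actB d e l v' w) = actA b a d u x"
      using B.act_Cmp[OF W(1) W(2) K(2) X(2) v'(1) mD(5) W(3)] v' uv by simp
    also have "\<dots> = actA b c d u' (actB c l b m y)"
      using A.act_Cmp[OF X(2) X(1) K(1) W(1) kD(5) u'(1) X(3)] u' y_eq by simp
    also have "\<dots> = actB d l b m (actA l c d u' y)"
      using act_commute[OF K(1) W(1) K(2) X(2) u'(1) mD(5) y] by simp
    finally have "actB d e l v' w = actA l c d u' y"
      using B.act_kernel_inj[OF m W(1) cl] by blast
    then have "mor u' v' \<in> Hom D (obj d e w) (obj c l y)"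
      using W K y u' v' by (simp add: mor_in_Hom)
    moreover have "Cmp D (obj d e w) (obj c l y) (obj a b x) (mor k m) (mor u' v') = t'"
      using u' v' by (simp add: Cmp_D t'_eq)
    moreover have "t = mor u' v'"
      if t: "t \<in> Hom D (obj d e w) (obj c l y)"
        "Cmp D (obj d e w) (obj c l y) (obj a b x) (mor k m) t = t'" for t
    proof -
      obtain p q where pq: "t = mor p q" "p \<in> Hom A c d" "q \<in> Hom B e l"
        using Hom_D_cases[OF t(1) W K y] by blast
      then have "Cmp A a c d p k = u" "Cmp B e l b m q = v"
        using t(2) by (simp_all add: Cmp_D t'_eq mor_inject)
      then show ?thesis using pq u' v' u1 v1 by blast
    qed
    ultimately show ?thesis by blast
  qed
  show ?thesis
    unfolding is_kernel_def ball_Ob_D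
    using obj_in_Ob X X' K y h km comp univ by blast
qed

lemma kernel_D_exists:
  assumes X: "a \<in> Ob A" "b \<in> Ob B" "x \<in> carrier (N a b)"
    and X': "a' \<in> Ob A" "b' \<in> Ob B" "x' \<in> carrier (N a' b')"
    and h: "mor f g \<in> Hom D (obj a b x) (obj a' b' x')"
    and k: "is_cokernel A a' a f c k" and m: "is_kernel B b b' g l m"
  obtains y where "y \<in> carrier (N c l)"
    "is_kernel D (obj a b x) (obj a' b' x') (mor f g) (obj c l y) (mor k m)"
proof -
  note kD = A.cokernelD[OF k] and mD = B.kernelD[OF m]
  have K: "c \<in> Ob A" "l \<in> Ob B" by fact+
  have fg: "actB a b b' g x = actA b' a' a f x'" using h X X' by (simp add: mor_in_Hom)
  \<comment> \<open>To lift the image of \<open>x\<close> under \<open>k\<close> along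
    \<open>m\<close>, it must be killed by \<open>g\<close>. Interchange lets \<open>g\<close> act
    first, matching turns the result into the image of \<open>x'\<close> under \<open>f\<close>, and
    \<open>k\<close> after \<open>f\<close> is zero.\<close>
  have "actB c b b' g (actA b a c k x) = actA b' a c k (actB a b b' g x)"
    using act_commute[OF X(1) K(1) X(2) X'(2) kD(5) mD(3) X(3)] .
  also have "\<dots> = actA b' a' c (Cmp A a' a c k f) x'"
    using A.act_Cmp[OF X'(2) X'(1) X(1) K(1) kD(3) kD(5) X'(3)] fg by simp
  also have "\<dots> = \<zero>\<^bsub>N c b'\<^esub>"
    using A.act_zero_mor[OF X'(2) X'(1) K(1) X'(3)] kD(6) by simp
  finally obtain y where "y \<in> carrier (N c l)" "actB c l b m y = actA b a c k x"
    using B.act_kernel_lift[OF m K(1) A.act_closed[OF X(2) X(1) K(1) kD(5) X(3)]] by blast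
  then show ?thesis using that is_kernel_D[OF X X' h k m] by blast
qed

lemma ex_kernel_D:
  assumes "X \<in> Ob D" "Y \<in> Ob D" and h: "h \<in> Hom D X Y"
  shows "\<exists>K k. is_kernel D X Y h K k"
proof -
  obtain a b x where X: "X = obj a b x" "a \<in> Ob A" "b \<in> Ob B" "x \<in> carrier (N a b)"
    using assms(1) by (rule Ob_D_cases)
  obtain a' b' x' where Y: "Y = obj a' b' x'" "a' \<in> Ob A" "b' \<in> Ob B" "x' \<in> carrier (N a' b')"
    using assms(2) by (rule Ob_D_cases)
  obtain f g where fg: "h = mor f g" "f \<in> Hom A a' a" "g \<in> Hom B b b'"
    using h unfolding X(1) Y(1) by (rule Hom_D_cases[OF _ X(2-4) Y(2-4)])
  obtain c k where k: "is_cokernel A a' a f c k" using A.ex_cokernel X Y fg by blast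
  obtain l m where m: "is_kernel B b b' g l m" using B.ex_kernel X Y fg by blast
  show ?thesis
    using kernel_D_exists[OF X(2-4) Y(2-4) _ k m] h unfolding X(1) Y(1) fg(1) by blast
qed

section \<open>Monomorphisms of the gluing\<close>

lemma mono_D_components:
  assumes X: "a \<in> Ob A" "b \<in> Ob B" "x \<in> carrier (N a b)"
    and X': "a' \<in> Ob A" "b' \<in> Ob B" "x' \<in> carrier (N a' b')"
    and mono: "is_mono D (obj a b x) (obj a' b' x') (mor f g)"
  shows "is_epi A a' a f" "is_mono B b b' g"
proof -
  have h: "mor f g \<in> Hom D (obj a b x) (obj a' b' x')" using mono by (simp add: is_mono_def)
  then have fg: "f \<in> Hom A a' a" "g \<in> Hom B b b'" using X X' by (simp_all add: mor_in_Hom)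
  obtain c k where k: "is_cokernel A a' a f c k" using A.ex_cokernel X X' fg by blast
  obtain l m where m: "is_kernel B b b' g l m" using B.ex_kernel X X' fg by blast
  note kD = A.cokernelD[OF k] and mD = B.kernelD[OF m]
  have K: "c \<in> Ob A" "l \<in> Ob B" by fact+
  obtain y where y: "y \<in> carrier (N c l)"
    and ker: "is_kernel D (obj a b x) (obj a' b' x') (mor f g) (obj c l y) (mor k m)"
    using kernel_D_exists[OF X X' h k m] .
  have km: "mor k m \<in> Hom D (obj c l y) (obj a b x)"
    using ker by (simp add: is_kernel_def)
  have z: "mor \<zero>\<^bsub>GA a c\<^esub> \<zero>\<^bsub>GB l b\<^esub> \<in> Hom D (obj c l y) (obj a b x)"
    using X K y by (simp add: mor_in_Hom A.hom_zero B.hom_zero A.act_zero_mor B.act_zero_mor)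
  \<comment> \<open>The kernel inclusion and the pair of zeros have the same composite with the
    monomorphism, so they coincide. Thus \<open>k\<close> and \<open>m\<close> vanish, and any map
    killed by a component factors through a zero map.\<close>
  have "Cmp D (obj c l y) (obj a b x) (obj a' b' x') (mor f g) (mor k m) =
    Cmp D (obj c l y) (obj a b x) (obj a' b' x') (mor f g) (mor \<zero>\<^bsub>GA a c\<^esub> \<zero>\<^bsub>GB l b\<^esub>)"
    using X X' K fg kD mD by (simp add: Cmp_D A.Cmp_zero_left B.Cmp_zero_right)
  then have "mor k m = mor \<zero>\<^bsub>GA a c\<^esub> \<zero>\<^bsub>GB l b\<^esub>"
    using mono km z obj_in_Ob[OF K y] unfolding is_mono_def by blast
  then have k0: "k = \<zero>\<^bsub>GA a c\<^esub>" and m0: "m = \<zero>\<^bsub>GB l b\<^esub>" by (simp_all add: mor_inject)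
  show "is_mono B b b' g"
  proof (rule B.is_monoI[OF X(2) X'(2) fg(2)])
    fix W u assume W: "W \<in> Ob B" and u: "u \<in> Hom B W b" "Cmp B W b b' g u = \<zero>\<^bsub>GB W b'\<^esub>"
    then obtain v where "v \<in> Hom B W l" "Cmp B W l b m v = u" using mD(7) by blast
    then show "u = \<zero>\<^bsub>GB W b\<^esub>" using m0 B.Cmp_zero_left W K X by metis
  qed
  \<comment> \<open>An epimorphism is by definition a monomorphism of the opposite category, so the
    criterion \<open>is_monoI\<close> is applied there.\<close>
  interpret opA: preadditive_category "op_cat A" "\<lambda>X Y. GA Y X" by (rule A.preadditive_op)
  show "is_epi A a' a f"
    unfolding is_epi_def
  proof (rule opA.is_monoI; simp only: op_cat_simps X X' fg)
    fix W u assume W: "W \<in> Ob A" and u: "u \<in> Hom A a W" "Cmp A a' a W u f = \<zero>\<^bsub>GA a' W\<^esub>"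
    then obtain v where "v \<in> Hom A c W" "Cmp A a c W v k = u" using kD(7) by blast
    then show "u = \<zero>\<^bsub>GA a W\<^esub>" using k0 A.Cmp_zero_right W K X by metis
  qed
qed

lemma mono_is_kernel_D:
  assumes mono: "is_mono D X Y h"
  shows "\<exists>Z f. is_kernel D Y Z f X h"
proof -
  have "X \<in> Ob D" "Y \<in> Ob D" and h: "h \<in> Hom D X Y" using mono by (simp_all add: is_mono_def)
  then obtain a b x a' b' x' where X: "X = obj a b x" "a \<in> Ob A" "b \<in> Ob B" "x \<in> carrier (N a b)"
    and Y: "Y = obj a' b' x'" "a' \<in> Ob A" "b' \<in> Ob B" "x' \<in> carrier (N a' b')"
    by (metis Ob_D_cases)
  obtain f g where h_eq: "h = mor f g" and fg: "f \<in> Hom A a' a" "g \<in> Hom B b b'"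
    and eq: "actB a b b' g x = actA b' a' a f x'"
    using h unfolding X(1) Y(1) by (rule Hom_D_cases[OF _ X(2-4) Y(2-4)])
  note comps = mono_D_components[OF X(2-4) Y(2-4) mono[unfolded X(1) Y(1) h_eq]]
  \<comment> \<open>These give the components of a map out of \<open>Y\<close> that kills
    \<open>h\<close>. With \<open>A\<close> contravariant, the first one is a kernel of
    \<open>f\<close> and the second a cokernel of \<open>g\<close>.\<close>
  obtain p i where i: "is_kernel A a' a f p i" using A.ex_kernel X Y fg by blast
  obtain q j where j: "is_cokernel B b b' g q j" using B.ex_cokernel X Y fg by blast
  note iD = A.kernelD[OF i] and jD = B.cokernelD[OF j]
  have P: "p \<in> Ob A" "q \<in> Ob B" by fact+
  have f: "is_cokernel A p a' i a f" using A.epi_cokernel_of_kernel[OF comps(1) i] .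
  have g: "is_kernel B b' q j b g" using B.mono_kernel_of_cokernel[OF comps(2) j] .
  \<comment> \<open>The image of \<open>x'\<close> under \<open>j\<close> is killed by
    \<open>f\<close>: interchange and matching rewrite it as the action of \<open>j\<close> after
    \<open>g\<close>, which is zero. Left exactness on the \<open>A\<close> side then supplies the
    element of the new object.\<close>
  have "actA q a' a f (actB a' b' q j x') = actB a b' q j (actB a b b' g x)"
    using act_commute[OF Y(2) X(2) Y(3) P(2) fg(1) jD(5) Y(4)] eq by simp
  also have "\<dots> = \<zero>\<^bsub>N a q\<^esub>"
    using B.act_Cmp[OF X(2,3) Y(3) P(2) fg(2) jD(5) X(4)] jD(6) B.act_zero_mor[OF X(2,3) P(2) X(4)]
    by simp
  finally obtain y where y: "y \<in> carrier (N p q)" "actA q p a' i y = actB a' b' q j x'"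
    using A.act_kernel_lift[OF i P(2) B.act_closed[OF Y(2,3) P(2) jD(5) Y(4)]] by blast
  have "mor i j \<in> Hom D (obj a' b' x') (obj p q y)"
    using Y P y iD(5) jD(5) by (simp add: mor_in_Hom)
  \<comment> \<open>The element required over the kernel is \<open>x\<close> itself, since the
    condition on it is the matching condition \<open>eq\<close> of the given morphism.\<close>
  then show ?thesis
    using is_kernel_D[OF Y(2-4) P y(1) _ f g X(4) eq] X(1) Y(1) h_eq by blast
qed

end

section \<open>Biproducts, and products in the gluing\<close>

lemma (in preadditive_category) product_is_biproduct:
  assumes zero: "is_zero_object C Z" and prod: "is_product C X Y P p q"
  obtains i j where "i \<in> Hom C X P" "j \<in> Hom C Y P"
    "Cmp C X P X p i = Idn C X" "Cmp C X P Y q i = \<zero>\<^bsub>G X Y\<^esub>"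
    "Cmp C Y P X p j = \<zero>\<^bsub>G Y X\<^esub>" "Cmp C Y P Y q j = Idn C Y"
    "Cmp C P X P i p \<oplus>\<^bsub>G P P\<^esub> Cmp C P Y P j q = Idn C P"
proof -
  have Ob: "X \<in> Ob C" "Y \<in> Ob C" "P \<in> Ob C" and pq: "p \<in> Hom C P X" "q \<in> Hom C P Y"
    and univ: "\<And>W f g. \<lbrakk>W \<in> Ob C; f \<in> Hom C W X; g \<in> Hom C W Y\<rbrakk> \<Longrightarrow>
      \<exists>!u. u \<in> Hom C W P \<and> Cmp C W P X p u = f \<and> Cmp C W P Y q u = g"
    using prod unfolding is_product_def by blast+
  obtain i where i: "i \<in> Hom C X P" "Cmp C X P X p i = Idn C X" "Cmp C X P Y q i = \<zero>\<^bsub>G X Y\<^esub>"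
    using univ[OF Ob(1) Idn_in_Hom hom_zero] Ob by blast
  obtain j where j: "j \<in> Hom C Y P" "Cmp C Y P X p j = \<zero>\<^bsub>G Y X\<^esub>" "Cmp C Y P Y q j = Idn C Y"
    using univ[OF Ob(2) hom_zero Idn_in_Hom] Ob by blast
  interpret PX: abelian_group "G P X" using hom_group Ob by blast
  interpret PY: abelian_group "G P Y" using hom_group Ob by blast
  have ip: "Cmp C P X P i p \<in> Hom C P P" and jq: "Cmp C P Y P j q \<in> Hom C P P"
    using Cmp_in_Hom Ob pq i j by blast+
  let ?e = "Cmp C P X P i p \<oplus>\<^bsub>G P P\<^esub> Cmp C P Y P j q"
  have "Cmp C P P X p ?e = Cmp C P X X (Cmp C X P X p i) p \<oplus>\<^bsub>G P X\<^esub> Cmp C P Y X (Cmp C Y P X p j) q"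
    using Cmp_add_right[OF Ob(3,3,1) ip jq pq(1)] Cmp_assoc Ob pq i j by simp
  also have "\<dots> = p"
    using i j Ob pq hom_carrier Cmp_Idn_left Cmp_zero_left PX.r_zero by metis
  finally have p: "Cmp C P P X p ?e = p" .
  have "Cmp C P P Y q ?e = Cmp C P X Y (Cmp C X P Y q i) p \<oplus>\<^bsub>G P Y\<^esub> Cmp C P Y Y (Cmp C Y P Y q j) q"
    using Cmp_add_right[OF Ob(3,3,2) ip jq pq(2)] Cmp_assoc Ob pq i j by simp
  also have "\<dots> = q"
    using i j Ob pq hom_carrier Cmp_Idn_left Cmp_zero_left PY.l_zero by metis
  finally have q: "Cmp C P P Y q ?e = q" .
  \<comment> \<open>Both maps have the projections \<open>p\<close> and \<open>q\<close>, so
    uniqueness in the universal property identifies them.\<close>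
  have "?e = Idn C P"
    using univ[OF Ob(3) pq] p q hom_add[OF Ob(3,3) ip jq] Idn_in_Hom[OF Ob(3)]
      Cmp_Idn_right[OF Ob(3,1) pq(1)] Cmp_Idn_right[OF Ob(3,2) pq(2)] by blast
  then show ?thesis using that i j by blast
qed

context gluing
begin

text \<open>The underlying objects are a coproduct in \<open>A\<close> and a product in
  \<open>B\<close>. The biproduct injections \<open>i\<close> and \<open>j\<close> assemble the
  element of the product object from \<open>x\<close> and \<open>x'\<close>, and the identity
  \<open>ij\<close> recovers an element of \<open>N k d\<close> from its two projections.\<close>

lemma ex_product_D:
  assumes X: "a \<in> Ob A" "b \<in> Ob B" "x \<in> carrier (N a b)"
    and X': "a' \<in> Ob A" "b' \<in> Ob B" "x' \<in> carrier (N a' b')"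
    and p: "is_product (op_cat A) a a' c p p'" and q: "is_product B b b' d q q'"
  shows "\<exists>P r s. is_product D (obj a b x) (obj a' b' x') P r s"
proof -
  obtain w where "is_zero_object B w" using B.ex_zero_object by blast
  then obtain i j where i: "i \<in> Hom B b d" "Cmp B b d b q i = Idn B b" "Cmp B b d b' q' i = \<zero>\<^bsub>GB b b'\<^esub>"
    and j: "j \<in> Hom B b' d" "Cmp B b' d b q j = \<zero>\<^bsub>GB b' b\<^esub>" "Cmp B b' d b' q' j = Idn B b'"
    and ij: "Cmp B d b d i q \<oplus>\<^bsub>GB d d\<^esub> Cmp B d b' d j q' = Idn B d"
    using B.product_is_biproduct q by metis
  have c: "c \<in> Ob A" and pHom: "p \<in> Hom A a c" "p' \<in> Hom A a' c"
    and p_univ: "\<And>W f g. \<lbrakk>W \<in> Ob A; f \<in> Hom A a W; g \<in> Hom A a' W\<rbrakk> \<Longrightarrow>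
      \<exists>!u. u \<in> Hom A c W \<and> Cmp A a c W u p = f \<and> Cmp A a' c W u p' = g"
    using p unfolding is_product_def op_cat_simps by blast+
  have d: "d \<in> Ob B" and qHom: "q \<in> Hom B d b" "q' \<in> Hom B d b'"
    and q_univ: "\<And>W f g. \<lbrakk>W \<in> Ob B; f \<in> Hom B W b; g \<in> Hom B W b'\<rbrakk> \<Longrightarrow>
      \<exists>!u. u \<in> Hom B W d \<and> Cmp B W d b q u = f \<and> Cmp B W d b' q' u = g"
    using q unfolding is_product_def by blast+
  interpret cb: abelian_group "N c b" using B.N_group c X by blast
  interpret cb': abelian_group "N c b'" using B.N_group c X' by blast
  interpret cd: abelian_group "N c d" using B.N_group c d by blast
  \<comment> \<open>\<open>x\<close> and \<open>x'\<close> are first moved to \<open>c\<close> along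
    the coprojections \<open>p\<close> and \<open>p'\<close>. Then \<open>z\<close> is built to have
    \<open>y\<close> and \<open>y'\<close> as its images under \<open>q\<close> and
    \<open>q'\<close>.\<close>
  define y where "y = actA b a c p x"
  define y' where "y' = actA b' a' c p' x'"
  define z where "z = actB c b d i y \<oplus>\<^bsub>N c d\<^esub> actB c b' d j y'"
  have y: "y \<in> carrier (N c b)" and y': "y' \<in> carrier (N c b')"
    unfolding y_def y'_def using A.act_closed X X' c pHom by blast+
  have iy: "actB c b d i y \<in> carrier (N c d)" and jy': "actB c b' d j y' \<in> carrier (N c d)"
    using B.act_closed c d X X' i j y y' by blast+
  then have z: "z \<in> carrier (N c d)" unfolding z_def by blast
  have "actB c d b q z = actB c b b (Cmp B b d b q i) y \<oplus>\<^bsub>N c b\<^esub> actB c b' b (Cmp B b' d b q j) y'"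
    unfolding z_def using X X' c d qHom iy jy' y y' i(1) j(1) by (simp add: B.act_add B.act_Cmp)
  then have qz: "actB c d b q z = y"
    using i j c X X' y y' by (simp add: B.act_Idn B.act_zero_mor)
  have "actB c d b' q' z = actB c b b' (Cmp B b d b' q' i) y \<oplus>\<^bsub>N c b'\<^esub> actB c b' b' (Cmp B b' d b' q' j) y'"
    unfolding z_def using X X' c d qHom iy jy' y y' i(1) j(1) by (simp add: B.act_add B.act_Cmp)
  then have q'z: "actB c d b' q' z = y'"
    using i j c X X' y y' by (simp add: B.act_Idn B.act_zero_mor)
  have r: "mor p q \<in> Hom D (obj c d z) (obj a b x)"
    using X c d z pHom qHom qz y_def by (simp add: mor_in_Hom)
  have s: "mor p' q' \<in> Hom D (obj c d z) (obj a' b' x')"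
    using X' c d z pHom qHom q'z y'_def by (simp add: mor_in_Hom)
  have univ: "\<exists>!t. t \<in> Hom D (obj k l w) (obj c d z) \<and>
      Cmp D (obj k l w) (obj c d z) (obj a b x) (mor p q) t = h \<and>
      Cmp D (obj k l w) (obj c d z) (obj a' b' x') (mor p' q') t = h'"
    if W: "k \<in> Ob A" "l \<in> Ob B" "w \<in> carrier (N k l)"
      and h: "h \<in> Hom D (obj k l w) (obj a b x)" and h': "h' \<in> Hom D (obj k l w) (obj a' b' x')"
    for k l w h h'
  proof -
    obtain f g where h_eq: "h = mor f g" and fg: "f \<in> Hom A a k" "g \<in> Hom B l b"
      and e: "actB k l b g w = actA b a k f x"
      using Hom_D_cases[OF h W X] by blast
    obtain f' g' where h'_eq: "h' = mor f' g'" and fg': "f' \<in> Hom A a' k" "g' \<in> Hom B l b'"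
      and e': "actB k l b' g' w = actA b' a' k f' x'"
      using Hom_D_cases[OF h' W X'] by blast
    have u1: "\<exists>!u. u \<in> Hom A c k \<and> Cmp A a c k u p = f \<and> Cmp A a' c k u p' = f'"
      using p_univ W fg fg' by blast
    have v1: "\<exists>!v. v \<in> Hom B l d \<and> Cmp B l d b q v = g \<and> Cmp B l d b' q' v = g'"
      using q_univ W fg fg' by blast
    obtain u where u: "u \<in> Hom A c k" "Cmp A a c k u p = f" "Cmp A a' c k u p' = f'" using u1 by blast
    obtain v where v: "v \<in> Hom B l d" "Cmp B l d b q v = g" "Cmp B l d b' q' v = g'" using v1 by blast
    let ?vw = "actB k l d v w"
    have vw: "?vw \<in> carrier (N k d)" using B.act_closed W d v by blast
    have uy: "actA b c k u y = actB k d b q ?vw"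
      unfolding y_def
      using A.act_Cmp[of b a c k p u x] B.act_Cmp[of k l d b v q w] e u v X W c d pHom qHom by simp
    have uy': "actA b' c k u y' = actB k d b' q' ?vw"
      unfolding y'_def
      using A.act_Cmp[of b' a' c k p' u x'] B.act_Cmp[of k l d b' v q' w] e' u v X' W c d pHom qHom by simp
    \<comment> \<open>This is the matching condition for \<open>(u, v)\<close>. Interchange moves
      \<open>u\<close> inside the injections, \<open>uy\<close> and \<open>uy'\<close> express the
      two parts as projections of \<open>?vw\<close>, and \<open>ij\<close> puts \<open>?vw\<close>
      together again.\<close>
    have "actA d c k u z = actA d c k u (actB c b d i y) \<oplus>\<^bsub>N k d\<^esub> actA d c k u (actB c b' d j y')"
      unfolding z_def using A.act_add d c W u iy jy' by simp
    also have "\<dots> = actB k b d i (actA b c k u y) \<oplus>\<^bsub>N k d\<^esub> actB k b' d j (actA b' c k u y')"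
      using act_commute[OF c W(1) X(2) d u(1) i(1) y] act_commute[OF c W(1) X'(2) d u(1) j(1) y'] by simp
    also have "\<dots> = actB k d d (Cmp B d b d i q) ?vw \<oplus>\<^bsub>N k d\<^esub> actB k d d (Cmp B d b' d j q') ?vw"
      unfolding uy uy' using W X X' d vw qHom i j by (simp add: B.act_Cmp)
    also have "\<dots> = actB k d d (Cmp B d b d i q \<oplus>\<^bsub>GB d d\<^esub> Cmp B d b' d j q') ?vw"
      using W X X' d vw qHom i j by (simp add: B.act_add_mor B.Cmp_in_Hom)
    also have "\<dots> = ?vw" using ij B.act_Idn W d vw by simp
    finally have "mor u v \<in> Hom D (obj k l w) (obj c d z)"
      using W c d z u v by (simp add: mor_in_Hom)
    moreover have "t = mor u v"
      if t: "t \<in> Hom D (obj k l w) (obj c d z)"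
        "Cmp D (obj k l w) (obj c d z) (obj a b x) (mor p q) t = h"
        "Cmp D (obj k l w) (obj c d z) (obj a' b' x') (mor p' q') t = h'" for t
    proof -
      obtain m n where mn: "t = mor m n" "m \<in> Hom A c k" "n \<in> Hom B l d"
        using Hom_D_cases[OF t(1) W c d z] by blast
      then have "Cmp A a c k m p = f" "Cmp B l d b q n = g" "Cmp A a' c k m p' = f'" "Cmp B l d b' q' n = g'"
        using t by (simp_all add: Cmp_D h_eq h'_eq mor_inject)
      then show ?thesis using mn u v u1 v1 by blast
    qed
    moreover have "Cmp D (obj k l w) (obj c d z) (obj a b x) (mor p q) (mor u v) = h"
      "Cmp D (obj k l w) (obj c d z) (obj a' b' x') (mor p' q') (mor u v) = h'"
      using u v by (simp_all add: Cmp_D h_eq h'_eq)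
    ultimately show ?thesis by blast
  qed
  have "is_product D (obj a b x) (obj a' b' x') (obj c d z) (mor p q) (mor p' q')"
    unfolding is_product_def ball_Ob_D
    by (intro conjI ballI univ obj_in_Ob X X' c d z r s)
  then show ?thesis by blast
qed

text \<open>Additivity and the existence of products are hypotheses: \<open>exact_family\<close>
  does not provide products, and the hom groups of \<open>D\<close> are written down for concrete
  pairs in \<open>gluing_preadditive\<close>.\<close>

lemma abelian_D:
  assumes "\<exists>G. preadditive_category D G"
    and coprod: "\<And>a a'. \<lbrakk>a \<in> Ob A; a' \<in> Ob A\<rbrakk> \<Longrightarrow> \<exists>P p q. is_product (op_cat A) a a' P p q"
    and prod: "\<And>b b'. \<lbrakk>b \<in> Ob B; b' \<in> Ob B\<rbrakk> \<Longrightarrow> \<exists>P p q. is_product B b b' P p q"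
  shows "abelian_category D"
proof
  show "\<exists>G. preadditive_category D G" by fact
  show "\<exists>Z. is_zero_object D Z" by (rule ex_zero_object_D)
next
  fix X Y assume "X \<in> Ob D" "Y \<in> Ob D"
  then show "\<exists>P p q. is_product D X Y P p q"
    by (elim Ob_D_cases) (metis ex_product_D coprod prod)
next
  fix X Y f assume h: "X \<in> Ob D" "Y \<in> Ob D" "f \<in> Hom D X Y"
  then show "\<exists>K k. is_kernel D X Y f K k" by (rule ex_kernel_D)
  show "\<exists>Q q. is_cokernel D X Y f Q q"
    unfolding is_cokernel_def using gluing.ex_kernel_D[OF dual] h by simp
next
  fix X Y m assume "is_mono D X Y m"
  then show "\<exists>Z f. is_kernel D Y Z f X m" by (rule mono_is_kernel_D)
next
  fix X Y e assume "is_epi D X Y e"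
  then show "\<exists>W f. is_cokernel D W X f Y e"
    unfolding is_cokernel_def is_epi_def by (rule gluing.mono_is_kernel_D[OF dual])
qed

end

text \<open>The matching condition is additive in \<open>(f, g)\<close>, so it cuts out a subgroup
  of the product of two hom groups. Fixing tuples and \<open>Pair\<close> as constructors lets the
  addition be defined by pattern matching.\<close>

lemma gluing_preadditive:
  fixes D :: "('a \<times> 'b \<times> 'x, 'ma \<times> 'mb, 'z) cat_scheme"
  assumes "gluing A GA B GB N actA actB D (\<lambda>a b x. (a, b, x)) Pair"
  shows "\<exists>G. preadditive_category D G"
proof -
  interpret gluing A GA B GB N actA actB D "\<lambda>a b x. (a, b, x)" Pair by (rule assms)
  define G :: "'a \<times> 'b \<times> 'x \<Rightarrow> 'a \<times> 'b \<times> 'x \<Rightarrow> ('ma \<times> 'mb) ring"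
    where "G = (\<lambda>(a, b, x) (a', b', x'). \<lparr>carrier = Hom D (a, b, x) (a', b', x'),
      mult = undefined, one = undefined, zero = (\<zero>\<^bsub>GA a' a\<^esub>, \<zero>\<^bsub>GB b b'\<^esub>),
      add = (\<lambda>(f, g) (f', g'). (f \<oplus>\<^bsub>GA a' a\<^esub> f', g \<oplus>\<^bsub>GB b b'\<^esub> g'))\<rparr>)"
  have "preadditive_category D G"
  proof (intro preadditive_category.intro preadditive_category_axioms.intro category_axioms)
    fix X Y assume "X \<in> Ob D" "Y \<in> Ob D"
    then obtain a b x a' b' x' where X: "X = (a, b, x)" "a \<in> Ob A" "b \<in> Ob B" "x \<in> carrier (N a b)"
      and Y: "Y = (a', b', x')" "a' \<in> Ob A" "b' \<in> Ob B" "x' \<in> carrier (N a' b')"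
      by (metis Ob_D_cases)
    interpret GA: abelian_group "GA a' a" using A.hom_group X Y by blast
    interpret GB: abelian_group "GB b b'" using B.hom_group X Y by blast
    have carr: "carrier (GA a' a) = Hom A a' a" "carrier (GB b b') = Hom B b b'"
      using A.hom_carrier B.hom_carrier X Y by blast+
    note H = mor_in_Hom[OF X(2-4) Y(2-4)] and XY = X(2-4) Y(2-4)
    show "carrier (G X Y) = Hom D X Y" by (simp add: G_def X Y)
    show "abelian_group (G X Y)"
    proof (rule abelian_groupI)
      fix h assume "h \<in> carrier (G X Y)"
      then obtain f g where h: "h = (f, g)" "f \<in> Hom A a' a" "g \<in> Hom B b b'" "actB a b b' g x = actA b' a' a f x'"
        using H by (cases h) (auto simp: G_def X Y)
      then show "\<exists>k\<in>carrier (G X Y). k \<oplus>\<^bsub>G X Y\<^esub> h = \<zero>\<^bsub>G X Y\<^esub>"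
        using XY carr
        by (intro bexI[of _ "(\<ominus>\<^bsub>GA a' a\<^esub> f, \<ominus>\<^bsub>GB b b'\<^esub> g)"])
          (auto simp: G_def X(1) Y(1) H A.hom_minus B.hom_minus A.act_minus_mor B.act_minus_mor
            GA.l_neg GB.l_neg)
    qed (use XY carr in \<open>auto simp: G_def X(1) Y(1) H A.hom_add B.hom_add A.act_add_mor B.act_add_mor
        A.hom_zero B.hom_zero A.act_zero_mor B.act_zero_mor GA.a_ac GB.a_ac\<close>)
  next
    fix X Y Z h k k'
    assume "X \<in> Ob D" "Y \<in> Ob D" "Z \<in> Ob D" "h \<in> Hom D X Y" "k \<in> Hom D Y Z" "k' \<in> Hom D Y Z"
    then show "Cmp D X Y Z (k \<oplus>\<^bsub>G Y Z\<^esub> k') h = Cmp D X Y Z k h \<oplus>\<^bsub>G X Z\<^esub> Cmp D X Y Z k' h"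
      by (cases h, cases k, cases k')
        (auto simp: Ob_D G_def mor_in_Hom Cmp_D A.Cmp_add_right B.Cmp_add_left)
  next
    fix X Y Z h h' k
    assume "X \<in> Ob D" "Y \<in> Ob D" "Z \<in> Ob D" "h \<in> Hom D X Y" "h' \<in> Hom D X Y" "k \<in> Hom D Y Z"
    then show "Cmp D X Y Z k (h \<oplus>\<^bsub>G X Y\<^esub> h') = Cmp D X Y Z k h \<oplus>\<^bsub>G X Z\<^esub> Cmp D X Y Z k h'"
      by (cases h, cases h', cases k)
        (auto simp: Ob_D G_def mor_in_Hom Cmp_D A.Cmp_add_left B.Cmp_add_right)
  qed
  then show ?thesis by blast
qed

section \<open>From linear categories and bifunctors to the symmetric setting\<close>

lemma abelian_group_truncate:
  assumes "abelian_group N"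
  shows "abelian_group (ring.truncate N)"
proof -
  interpret N: abelian_group N by fact
  show ?thesis
    by (rule abelian_groupI) (auto simp: ring.defs N.a_ac intro: N.l_neg N.a_inv_closed)
qed

text \<open>The hom groups come from \<open>HomM\<close>, truncated to ring records, because the
  bilinearity of the bifunctor is stated for that addition. The other axioms concern the bare
  category and carry over from \<open>abelian_category\<close>.\<close>

lemma linear_abelian_is_preabelian:
  assumes "linear_category R C" "abelian_category C"
  shows "preabelian_category C (\<lambda>X Y. ring.truncate (HomM C X Y))"
proof -
  interpret linear_category R C by fact
  interpret ab: abelian_category C by fact
  show ?thesis
  proof (intro preabelian_category.intro preadditive_category.intro preadditive_category_axioms.intro
      preabelian_category_axioms.intro)
    show "category C" by (rule category_axioms)
    show "abelian_group (ring.truncate (HomM C X Y))" if "X \<in> Ob C" "Y \<in> Ob C" for X Y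
      using abelian_group_truncate module.axioms(2) hom_module[OF that] by blast
  qed (simp_all add: hom_carrier Cmp_add_left Cmp_add_right ring.defs
      ab.ex_zero_object ab.ex_kernel ab.ex_cokernel ab.mono_is_kernel ab.epi_is_cokernel)
qed

theorem theorem2p6:
  fixes R :: "('r, 'k) ring_scheme"
    and \<A> :: "('r, 'a, 'ma, 'za) lin_cat_scheme"
    and \<B> :: "('r, 'b, 'mb, 'zb) lin_cat_scheme"
    and M :: "('r, 'a, 'ma, 'b, 'mb, 'x) bifunctor"
  assumes "cring R"
    and "linear_category R \<A>" and "abelian_category \<A>"
    and "linear_category R \<B>" and "abelian_category \<B>"
    and "linear_bifunctor R \<A> \<B> M"
    and "\<And>A. A \<in> Ob \<A> \<Longrightarrow> left_exact \<B> (\<lambda>B. bi_ob M A B) (bi_fix_left_map \<A> M A)"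
    and "\<And>B. B \<in> Ob \<B> \<Longrightarrow> left_exact (op_cat \<A>) (\<lambda>A. bi_ob M A B) (bi_fix_right_map \<B> M B)"
  shows "abelian_category (glue \<A> \<B> M)"
proof -
  interpret M: linear_bifunctor R \<A> \<B> M by fact
  interpret abA: abelian_category \<A> by fact
  interpret abB: abelian_category \<B> by fact
  interpret A: preabelian_category \<A> "\<lambda>X Y. ring.truncate (HomM \<A> X Y)"
    using assms(2,3) by (rule linear_abelian_is_preabelian)
  interpret B: preabelian_category \<B> "\<lambda>X Y. ring.truncate (HomM \<B> X Y)"
    using assms(4,5) by (rule linear_abelian_is_preabelian)
  note lin = M.bi_linear[unfolded linear_map_def]
  have N_group: "abelian_group (bi_ob M A B)" if "A \<in> Ob \<A>" "B \<in> Ob \<B>" for A B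
    using M.bi_module[OF that] by (rule module.axioms(2))
  have "exact_family (op_cat \<A>) (\<lambda>X Y. ring.truncate (HomM \<A> Y X)) (Ob \<B>) (\<lambda>B A. bi_ob M A B)
    (bi_fix_right_map \<B> M)"
  proof (intro exact_family.intro exact_family_axioms.intro A.preabelian_op)
    fix B X Y Z f g x
    assume "B \<in> Ob \<B>" "X \<in> Ob (op_cat \<A>)" "Y \<in> Ob (op_cat \<A>)" "Z \<in> Ob (op_cat \<A>)"
      "f \<in> Hom (op_cat \<A>) X Y" "g \<in> Hom (op_cat \<A>) Y Z" "x \<in> carrier (bi_ob M X B)"
    \<comment> \<open>Writing the identity of \<open>B\<close> as its own square makes a composite
      in one variable an instance of \<open>bi_Cmp\<close>.\<close>
    then show "bi_fix_right_map \<B> M B X Z (Cmp (op_cat \<A>) X Y Z g f) x =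
        bi_fix_right_map \<B> M B Y Z g (bi_fix_right_map \<B> M B X Y f x)"
      using M.bi_Cmp[of Z Y X B B B g f "Idn \<B> B" "Idn \<B> B" x] M.B.Cmp_Idn_left[of B B "Idn \<B> B"]
      by (simp add: bi_fix_right_map_def M.B.Idn_in_Hom)
  qed (use lin N_group assms(8) in
      \<open>auto simp: bi_fix_right_map_def M.B.Idn_in_Hom M.bi_Idn M.bi_add_left ring.defs Pi_iff\<close>)
  then interpret A': exact_family "op_cat \<A>" "\<lambda>X Y. ring.truncate (HomM \<A> Y X)" "Ob \<B>"
    "\<lambda>B A. bi_ob M A B" "bi_fix_right_map \<B> M" .
  have "exact_family \<B> (\<lambda>X Y. ring.truncate (HomM \<B> X Y)) (Ob (op_cat \<A>)) (bi_ob M)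
    (bi_fix_left_map \<A> M)"
  proof (intro exact_family.intro exact_family_axioms.intro B.preabelian_category_axioms)
    fix A X Y Z f g x
    assume "A \<in> Ob (op_cat \<A>)" "X \<in> Ob \<B>" "Y \<in> Ob \<B>" "Z \<in> Ob \<B>"
      "f \<in> Hom \<B> X Y" "g \<in> Hom \<B> Y Z" "x \<in> carrier (bi_ob M A X)"
    then show "bi_fix_left_map \<A> M A X Z (Cmp \<B> X Y Z g f) x =
        bi_fix_left_map \<A> M A Y Z g (bi_fix_left_map \<A> M A X Y f x)"
      using M.bi_Cmp[of A A A X Y Z "Idn \<A> A" "Idn \<A> A" f g x] M.A.Cmp_Idn_left[of A A "Idn \<A> A"]
      by (simp add: bi_fix_left_map_def M.A.Idn_in_Hom)
  qed (use lin N_group assms(7) in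
      \<open>auto simp: bi_fix_left_map_def M.A.Idn_in_Hom M.bi_Idn M.bi_add_right ring.defs Pi_iff\<close>)
  then interpret B': exact_family \<B> "\<lambda>X Y. ring.truncate (HomM \<B> X Y)" "Ob (op_cat \<A>)" "bi_ob M"
    "bi_fix_left_map \<A> M" .
  \<comment> \<open>The first component runs backwards in \<open>op_cat \<A>\<close>, hence forwards
    in \<A>, as \<open>glue\<close> requires.\<close>
  have glue: "gluing (op_cat \<A>) (\<lambda>X Y. ring.truncate (HomM \<A> Y X)) \<B> (\<lambda>X Y. ring.truncate (HomM \<B> X Y))
    (bi_ob M) (bi_fix_right_map \<B> M) (bi_fix_left_map \<A> M) (glue \<A> \<B> M) (\<lambda>A B x. (A, B, x)) Pair"
  proof (intro gluing.intro gluing_axioms.intro A'.exact_family_axioms B'.exact_family_axioms)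
    fix A A' B B' f g x
    assume "A \<in> Ob (op_cat \<A>)" "A' \<in> Ob (op_cat \<A>)" "B \<in> Ob \<B>" "B' \<in> Ob \<B>"
      "f \<in> Hom (op_cat \<A>) A A'" "g \<in> Hom \<B> B B'" "x \<in> carrier (bi_ob M A B)"
    \<comment> \<open>Both orders of acting compute \<open>M(f, g)\<close>, which factors through
      identities in two ways.\<close>
    then show "bi_fix_left_map \<A> M A' B B' g (bi_fix_right_map \<B> M B A A' f x) =
        bi_fix_right_map \<B> M B' A A' f (bi_fix_left_map \<A> M A B B' g x)"
      using M.bi_Cmp[of A' A' A B B B' "Idn \<A> A'" f "Idn \<B> B" g x]
        M.bi_Cmp[of A' A A B B' B' f "Idn \<A> A" g "Idn \<B> B'" x]
        M.A.Cmp_Idn_left[of A' A f] M.A.Cmp_Idn_right[of A' A f] M.B.Cmp_Idn_left[of B B' g] M.B.Cmp_Idn_right[of B B' g]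
      by (simp add: bi_fix_left_map_def bi_fix_right_map_def M.A.Idn_in_Hom M.B.Idn_in_Hom)
  qed (auto simp: glue_def bi_fix_left_map_def bi_fix_right_map_def)
  then interpret gluing "op_cat \<A>" "\<lambda>X Y. ring.truncate (HomM \<A> Y X)" \<B> "\<lambda>X Y. ring.truncate (HomM \<B> X Y)"
    "bi_ob M" "bi_fix_right_map \<B> M" "bi_fix_left_map \<A> M" "glue \<A> \<B> M" "\<lambda>A B x. (A, B, x)" Pair .
  \<comment> \<open>The coproducts demanded in \<open>op_cat \<A>\<close> are products in the double
    opposite of \<A>, which \<open>op_op\<close> turns into products in \<A>.\<close>
  show ?thesis
    by (rule abelian_D) (simp_all add: gluing_preadditive[OF glue] abA.ex_product abB.ex_product)
qed

end
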